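(* The quantised dynamical system is a complete invariant of a monomial ideal: if $\mathcal I$ and $\mathcal J$ are monomial ideals whose quantised dynamical systems are conjugate, then $\mathcal I$ and $\mathcal J$ are the same modulo a permutation of the variables. In particular, if the quantised dynamics of two subshifts on the same set of symbols are conjugate, then the subshifts are conjugate.
   Context: $\mathbb F_+^d$ is the free monoid of words in $\{1,\dots,d\}$; for $\mu=\mu_1\cdots\mu_n$ put $x^\mu=x_{\mu_1}\cdots x_{\mu_n}\in\mathbb C\langle x_1,\dots,x_d\rangle$ (noncommuting variables). A monomial ideal is a two-sided ideal generated by monomials; throughout, monomial ideals are generated by monomials of degree at least 2 (the zero ideal is allowed). For a monomial ideal $\mathcal I$ put $\Lambda^*=\{\mu: x^\mu\notin\mathcal I\}$; let $\mathcal F_X$ be the Hilbert space with orthonormal basis $\{e_\mu:\mu\in\Lambda^*\}$ and $T_ie_\nu=e_{i\nu}$ if $i\nu\in\Lambda^*$, $T_ie_\nu=0$ otherwise; $T_\mu=T_{\mu_1}\cdots T_{\mu_n}$, $T_\emptyset=I$. Let $A=C^*(T_\mu^*T_\mu:\mu\in\Lambda^* )$, a unital commutative C*-algebra, and $\alpha_i:A\to A$, $\alpha_i(a)=T_i^*aT_i$, which are $*$-endomorphisms. The quantised dynamical system (quantised dynamics) of $\mathcal I$ is $(A,\alpha_1,\dots,\alpha_d)$. Systems $(A,\alpha_1,\dots,\alpha_d)$ and $(B,\beta_1,\dots,\beta_d)$ with the same number of maps are conjugate if, after perhaps reordering the maps, there is a $*$-isomorphism $\gamma:A\to B$ with $\gamma\alpha_i=\beta_i\gamma$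 for all $i$. "The same modulo a permutation of the variables" means that the numbers of variables agree and some bijection of the variables carries $\mathcal I$ onto $\mathcal J$. A subshift on the symbols $\Sigma=\{1,\dots,d\}$ is a left subshift (closed $\Lambda\subseteq\Sigma^{\mathbb Z_-}$ with $\sigma^{-1}(\Lambda)\subseteq\Lambda$), a right subshift (closed $\Lambda\subseteq\Sigma^{\mathbb Z_+}$ with $\sigma(\Lambda)\subseteq\Lambda$) or a two-sided subshift (closed $\Lambda\subseteq\Sigma^{\mathbb Z}$ with $\sigma(\Lambda)=\Lambda$), where $\sigma$ is the backward shift $\sigma((x_i))_k=x_{k+1}$. Its quantised dynamics are those of the monomial ideal spanned by the $x^\mu$ with $\mu$ not occurring in any element of $\Lambda$. Conjugacy of two subshifts (of the same kind) is a homeomorphism intertwining the shift maps. *)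

theory Defs
  imports "HOL-Analysis.Analysis" "HOL-Library.Poly_Mapping"
begin

section \<open>Noncommutative polynomials and monomial ideals\<close>

text \<open>
  The variables are indexed by a finite type \<open>'a\<close>, so the number of variables is \<open>CARD('a)\<close>.
  The free monoid is the type \<open>'a list\<close> with concatenation; it is written additively only because
  the convolution product of \<^typ>\<open>'b \<Rightarrow>\<^sub>0 'c\<close> expects its exponents to form an additive monoid. With
  this instance \<open>'a list \<Rightarrow>\<^sub>0 complex\<close> is the free algebra on \<open>'a\<close>.
\<close>

instantiation list :: (type) monoid_add
begin
definition zero_list :: "'a list" where "zero_list = []"
definition plus_list :: "'a list \<Rightarrow> 'a list \<Rightarrow> 'a list" where "plus_list xs ys = xs @ ys"
instance by standard (simp_all add: zero_list_def plus_list_def)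
end

type_synonym 'a ncpoly = "'a list \<Rightarrow>\<^sub>0 complex"

definition monom_word :: "'a list \<Rightarrow> 'a ncpoly" where
  "monom_word \<mu> = Poly_Mapping.single \<mu> 1"

lemma monom_word_mult: "monom_word \<mu> * monom_word \<nu> = monom_word (\<mu> @ \<nu>)"
  by (simp add: monom_word_def Poly_Mapping.mult_single plus_list_def)

lemma monom_word_Nil: "monom_word [] = 1"
  by (simp add: monom_word_def flip: zero_list_def)

definition two_sided_ideal :: "'r::ring_1 set \<Rightarrow> bool" where
  "two_sided_ideal I \<longleftrightarrow>
     0 \<in> I \<and> (\<forall>p\<in>I. \<forall>q\<in>I. p + q \<in> I) \<and> (\<forall>p\<in>I. \<forall>r. r * p \<in> I \<and> p * r \<in> I)"

definition monomial_ideal :: "'a ncpoly set \<Rightarrow> bool" where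
  "monomial_ideal I \<longleftrightarrow>
     (\<exists>M. (\<forall>\<mu>\<in>M. 2 \<le> length \<mu>) \<and> I = two_sided_ideal hull (monom_word ` M))"

text \<open>The algebra homomorphism sending each variable \<open>x\<^sub>i\<close> to \<open>x\<^bsub>\<pi>(i)\<^esub>\<close>.\<close>

definition rename_vars :: "('a \<Rightarrow> 'b) \<Rightarrow> 'a ncpoly \<Rightarrow> 'b ncpoly" where
  "rename_vars \<pi> p =
     (\<Sum>\<mu>\<in>Poly_Mapping.keys p. Poly_Mapping.single (map \<pi> \<mu>) (Poly_Mapping.lookup p \<mu>))"

definition same_modulo_permutation :: "'a ncpoly set \<Rightarrow> 'b ncpoly set \<Rightarrow> bool" where
  "same_modulo_permutation I J \<longleftrightarrow> (\<exists>\<pi>. bij \<pi> \<and> rename_vars \<pi> ` I = J)"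

definition allowed_words :: "'a ncpoly set \<Rightarrow> 'a list set" where
  "allowed_words I = {\<mu>. monom_word \<mu> \<notin> I}"


section \<open>Bounded operators on \<open>\<ell>\<^sup>2(S)\<close>\<close>

text \<open>
  \<open>\<ell>\<^sup>2(S)\<close>, for a set \<open>S\<close> of indices, consists of the square summable functions that vanish off
  \<open>S\<close>. Its operators are total functions, normalised to be \<open>0\<close> outside \<open>\<ell>\<^sup>2(S)\<close>, so that equality of
  operators is equality of functions, the algebraic operations are the pointwise ones, and the
  product is composition.
\<close>

definition l2 :: "'w set \<Rightarrow> ('w \<Rightarrow> complex) set" where
  "l2 S = {f. (\<forall>w. w \<notin> S \<longrightarrow> f w = 0) \<and> (\<lambda>w. (cmod (f w))\<^sup>2) summable_on UNIV}"

definition l2_inner :: "('w \<Rightarrow> complex) \<Rightarrow> ('w \<Rightarrow> complex) \<Rightarrow> complex" where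
  "l2_inner f g = (\<Sum>\<^sub>\<infinity>w. f w * cnj (g w))"

definition l2_norm :: "('w \<Rightarrow> complex) \<Rightarrow> real" where
  "l2_norm f = sqrt (\<Sum>\<^sub>\<infinity>w. (cmod (f w))\<^sup>2)"

definition l2_basis :: "'w \<Rightarrow> ('w \<Rightarrow> complex)" where
  "l2_basis w = (\<lambda>v. if v = w then 1 else 0)"

type_synonym 'w operator = "('w \<Rightarrow> complex) \<Rightarrow> ('w \<Rightarrow> complex)"

definition bounded_operators :: "'w set \<Rightarrow> 'w operator set" where
  "bounded_operators S =
     {T. (\<forall>f\<in>l2 S. T f \<in> l2 S) \<and> (\<forall>f. f \<notin> l2 S \<longrightarrow> T f = (\<lambda>_. 0)) \<and>
         (\<forall>f\<in>l2 S. \<forall>g\<in>l2 S. T (\<lambda>w. f w + g w) = (\<lambda>w. T f w + T g w)) \<and>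
         (\<forall>c. \<forall>f\<in>l2 S. T (\<lambda>w. c * f w) = (\<lambda>w. c * T f w)) \<and>
         (\<exists>K. \<forall>f\<in>l2 S. l2_norm (T f) \<le> K * l2_norm f)}"

definition op_norm :: "'w set \<Rightarrow> 'w operator \<Rightarrow> real" where
  "op_norm S T = (SUP f\<in>{f \<in> l2 S. l2_norm f \<le> 1}. l2_norm (T f))"

definition op_id :: "'w set \<Rightarrow> 'w operator" where
  "op_id S = (\<lambda>f. if f \<in> l2 S then f else (\<lambda>_. 0))"

definition op_add :: "'w operator \<Rightarrow> 'w operator \<Rightarrow> 'w operator" where
  "op_add T U = (\<lambda>f w. T f w + U f w)"

definition op_diff :: "'w operator \<Rightarrow> 'w operator \<Rightarrow> 'w operator" where
  "op_diff T U = (\<lambda>f w. T f w - U f w)"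

definition op_scale :: "complex \<Rightarrow> 'w operator \<Rightarrow> 'w operator" where
  "op_scale c T = (\<lambda>f w. c * T f w)"

definition op_adjoint :: "'w set \<Rightarrow> 'w operator \<Rightarrow> 'w operator" where
  "op_adjoint S T =
     (THE U. U \<in> bounded_operators S \<and>
             (\<forall>f\<in>l2 S. \<forall>g\<in>l2 S. l2_inner (T f) g = l2_inner f (U g)))"

definition concrete_cstar_algebra :: "'w set \<Rightarrow> 'w operator set \<Rightarrow> bool" where
  "concrete_cstar_algebra S \<A> \<longleftrightarrow>
     \<A> \<subseteq> bounded_operators S \<and> (\<lambda>_ _. 0) \<in> \<A> \<and>
     (\<forall>T\<in>\<A>. \<forall>U\<in>\<A>. op_add T U \<in> \<A> \<and> T \<circ> U \<in> \<A>) \<and>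
     (\<forall>c. \<forall>T\<in>\<A>. op_scale c T \<in> \<A>) \<and>
     (\<forall>T\<in>\<A>. op_adjoint S T \<in> \<A>) \<and>
     (\<forall>X T. (\<forall>n::nat. X n \<in> \<A>) \<and> T \<in> bounded_operators S \<and>
            (\<lambda>n. op_norm S (op_diff (X n) T)) \<longlonglongrightarrow> 0 \<longrightarrow> T \<in> \<A>)"

text \<open>The unit of the generated algebra is not imposed.\<close>

definition cstar_generated :: "'w set \<Rightarrow> 'w operator set \<Rightarrow> 'w operator set" where
  "cstar_generated S G = concrete_cstar_algebra S hull G"


section \<open>Quantised dynamics\<close>

record 'e star_algebra =
  sa_carrier :: "'e set"
  sa_add :: "'e \<Rightarrow> 'e \<Rightarrow> 'e"
  sa_scale :: "complex \<Rightarrow> 'e \<Rightarrow> 'e"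
  sa_mult :: "'e \<Rightarrow> 'e \<Rightarrow> 'e"
  sa_star :: "'e \<Rightarrow> 'e"

definition star_isomorphism :: "'e star_algebra \<Rightarrow> 'f star_algebra \<Rightarrow> ('e \<Rightarrow> 'f) \<Rightarrow> bool" where
  "star_isomorphism A B \<gamma> \<longleftrightarrow>
     bij_betw \<gamma> (sa_carrier A) (sa_carrier B) \<and>
     (\<forall>a\<in>sa_carrier A. \<forall>b\<in>sa_carrier A.
        \<gamma> (sa_add A a b) = sa_add B (\<gamma> a) (\<gamma> b) \<and>
        \<gamma> (sa_mult A a b) = sa_mult B (\<gamma> a) (\<gamma> b)) \<and>
     (\<forall>c. \<forall>a\<in>sa_carrier A. \<gamma> (sa_scale A c a) = sa_scale B c (\<gamma> a)) \<and>
     (\<forall>a\<in>sa_carrier A. \<gamma> (sa_star A a) = sa_star B (\<gamma> a))"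

text \<open>A system is an algebra with a family of self-maps indexed by \<open>'i\<close>; only the values of the maps on
  the carrier matter. The reordering \<open>\<pi>\<close> forces both systems to have equally many maps.\<close>

type_synonym ('e, 'i) dyn_system = "'e star_algebra \<times> ('i \<Rightarrow> 'e \<Rightarrow> 'e)"

definition conjugate_systems :: "('e, 'i) dyn_system \<Rightarrow> ('f, 'j) dyn_system \<Rightarrow> bool" where
  "conjugate_systems \<A> \<B> \<longleftrightarrow>
     (\<exists>\<pi> \<gamma>. bij \<pi> \<and> star_isomorphism (fst \<A>) (fst \<B>) \<gamma> \<and>
        (\<forall>i. \<forall>a\<in>sa_carrier (fst \<A>). \<gamma> (snd \<A> i a) = snd \<B> (\<pi> i) (\<gamma> a)))"

text \<open>The creation operator \<open>T\<^sub>i\<close> on \<open>\<ell>\<^sup>2(L)\<close>, where \<open>L\<close> is the set of allowed words, written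
  coordinatewise: \<open>T\<^sub>i(\<Sum> f\<^sub>\<nu> e\<^sub>\<nu>) = \<Sum> f\<^sub>\<nu> e\<^bsub>i\<nu>\<^esub>\<close>, the last sum being over the \<open>\<nu>\<close> with \<open>i\<nu> \<in> L\<close>.\<close>

definition creation :: "'a list set \<Rightarrow> 'a \<Rightarrow> 'a list operator" where
  "creation L i = (\<lambda>f \<mu>. if f \<in> l2 L \<and> \<mu> \<in> L \<and> \<mu> \<noteq> [] \<and> hd \<mu> = i then f (tl \<mu>) else 0)"

lemma l2_basis_in_l2: "w \<in> S \<Longrightarrow> l2_basis w \<in> l2 S"
proof -
  assume "w \<in> S"
  have "(\<lambda>v. (cmod (l2_basis w v))\<^sup>2) summable_on UNIV
          \<longleftrightarrow> (\<lambda>v. (cmod (l2_basis w v))\<^sup>2) summable_on {w}"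
    by (rule summable_on_cong_neutral) (auto simp: l2_basis_def)
  with \<open>w \<in> S\<close> show ?thesis by (auto simp: l2_def l2_basis_def)
qed

lemma creation_basis:
  assumes "\<nu> \<in> L"
  shows "creation L i (l2_basis \<nu>) = (if i # \<nu> \<in> L then l2_basis (i # \<nu>) else (\<lambda>_. 0))"
  using l2_basis_in_l2[OF assms]
  by (auto simp: creation_def fun_eq_iff l2_basis_def neq_Nil_conv)

fun creation_word :: "'a list set \<Rightarrow> 'a list \<Rightarrow> 'a list operator" where
  "creation_word L [] = op_id L"
| "creation_word L (i # \<mu>) = creation L i \<circ> creation_word L \<mu>"

definition quantised_algebra :: "'a ncpoly set \<Rightarrow> 'a list operator star_algebra" where
  "quantised_algebra I =
     (let L = allowed_words I in
      \<lparr> sa_carrier = cstar_generated L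
          ((\<lambda>\<mu>. op_adjoint L (creation_word L \<mu>) \<circ> creation_word L \<mu>) ` L),
        sa_add = op_add,
        sa_scale = op_scale,
        sa_mult = (\<circ>),
        sa_star = op_adjoint L \<rparr>)"

definition quantised_dynamics :: "'a ncpoly set \<Rightarrow> ('a list operator, 'a) dyn_system" where
  "quantised_dynamics I =
     (let L = allowed_words I in
      (quantised_algebra I, \<lambda>i a. op_adjoint L (creation L i) \<circ> a \<circ> creation L i))"


section \<open>Subshifts\<close>

text \<open>Left, right and two-sided sequences are treated together: they are the functions on the index
  set \<open>{..0}\<close>, \<open>{0..}\<close> or all of \<^typ>\<open>int\<close> (extensional, as required by \<^const>\<open>product_topology\<close>).
  On left sequences the shift map is \<open>\<sigma>\<^sup>-\<^sup>1\<close>, that is \<open>x \<mapsto> (x\<^bsub>k-1\<^esub>)\<^sub>k\<close>; \<open>\<sigma>\<close> itself makes no sense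
  there.\<close>

datatype shift_kind = Left_Sided | Right_Sided | Two_Sided

fun shift_index :: "shift_kind \<Rightarrow> int set" where
  "shift_index Left_Sided = {..0}"
| "shift_index Right_Sided = {0..}"
| "shift_index Two_Sided = UNIV"

definition full_shift :: "shift_kind \<Rightarrow> (int \<Rightarrow> 'c) topology" where
  "full_shift s = product_topology (\<lambda>_. discrete_topology UNIV) (shift_index s)"

fun shift_map :: "shift_kind \<Rightarrow> (int \<Rightarrow> 'c) \<Rightarrow> (int \<Rightarrow> 'c)" where
  "shift_map Left_Sided x = restrict (\<lambda>k. x (k - 1)) (shift_index Left_Sided)"
| "shift_map Right_Sided x = restrict (\<lambda>k. x (k + 1)) (shift_index Right_Sided)"
| "shift_map Two_Sided x = restrict (\<lambda>k. x (k + 1)) (shift_index Two_Sided)"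

definition subshift :: "shift_kind \<Rightarrow> (int \<Rightarrow> 'c) set \<Rightarrow> bool" where
  "subshift s \<Lambda> \<longleftrightarrow> closedin (full_shift s) \<Lambda> \<and>
     (if s = Two_Sided then shift_map s ` \<Lambda> = \<Lambda> else shift_map s ` \<Lambda> \<subseteq> \<Lambda>)"

definition occurs_in :: "shift_kind \<Rightarrow> 'c list \<Rightarrow> (int \<Rightarrow> 'c) \<Rightarrow> bool" where
  "occurs_in s \<mu> x \<longleftrightarrow>
     (\<exists>k. \<forall>j<length \<mu>. k + int j \<in> shift_index s \<and> x (k + int j) = \<mu> ! j)"

definition subshift_ideal :: "shift_kind \<Rightarrow> (int \<Rightarrow> 'c) set \<Rightarrow> 'c ncpoly set" where
  "subshift_ideal s \<Lambda> =
     {\<Sum>\<mu>\<in>F. Poly_Mapping.single \<mu> (c \<mu>) | F c. finite F \<and> (\<forall>\<mu>\<in>F. \<forall>x\<in>\<Lambda>. \<not> occurs_in s \<mu> x)}"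

definition conjugate_subshifts ::
    "shift_kind \<Rightarrow> (int \<Rightarrow> 'c) set \<Rightarrow> (int \<Rightarrow> 'd) set \<Rightarrow> bool" where
  "conjugate_subshifts s \<Lambda> \<Gamma> \<longleftrightarrow>
     (\<exists>h. homeomorphic_map (subtopology (full_shift s) \<Lambda>) (subtopology (full_shift s) \<Gamma>) h \<and>
          (\<forall>x\<in>\<Lambda>. h (shift_map s x) = shift_map s (h x)))"

end

theory Submission
  imports Defs
begin

text \<open>
  Let \<open>L\<close> be the set of words \<open>\<mu>\<close> with \<open>x\<^sup>\<mu> \<notin> I\<close>; it is closed under passing to factors. The operator
  \<open>T\<^sub>\<mu>\<^sup>*T\<^sub>\<mu>\<close> is the projection onto the span of the \<open>e\<^sub>\<nu>\<close> with \<open>\<mu>\<nu> \<in> L\<close>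
  (\<open>initial_projection\<close>). It is \<open>0\<close> exactly if \<open>\<mu> \<notin> L\<close>, because for \<open>\<mu> \<in> L\<close> it fixes the vacuum
  vector (\<open>follower_projection_eq_0_iff\<close>). Moreover \<open>\<alpha>\<^sub>i(T\<^sub>\<mu>\<^sup>*T\<^sub>\<mu>) = T\<^bsub>\<mu>i\<^esub>\<^sup>*T\<^bsub>\<mu>i\<^esub>\<close>
  (\<open>quantised_map_follower_projection\<close>), so that the projections of all words arise from the
  unit by applying the maps of the system. A conjugacy preserves the unit and intertwines the maps;
  if \<open>\<pi>\<close> is the accompanying reordering, it therefore sends the projection of \<open>\<mu>\<close> to the projection
  of \<open>\<pi>(\<mu>)\<close>, and since it is injective, \<open>\<mu>\<close> is allowed for \<open>I\<close> if and only if \<open>\<pi>(\<mu>)\<close> is allowed for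
  \<open>J\<close> (\<open>conjugate_systems_allowed_words\<close>). The allowed words determine a monomial ideal, which is
  spanned by its monomials (\<open>monomial_ideal_iff\<close>).

  Conversely, a permutation of the variables matching the ideals induces a unitary between the Fock
  spaces, and conjugation by it is a conjugacy (\<open>conjugate_systems_of_allowed_words\<close>). Here one has
  to know that conjugation carries generated C*-algebras to generated C*-algebras. This is easy
  because the algebras in question consist of diagonal operators, for which adjoints are explicit.

  For subshifts the allowed words are the words that occur, and a subshift is determined by its words
  because it is closed and invariant (\<open>subshift_determined_by_words\<close>). So the bijection \<open>\<pi>\<close>, applied
  symbol by symbol, maps one subshift homeomorphically onto the other, and it commutes with the
  shift.
\<close>

section \<open>Bounded operators and their adjoints\<close>

definition is_adjoint :: "'w set \<Rightarrow> 'w operator \<Rightarrow> 'w operator \<Rightarrow> bool" where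
  "is_adjoint S T U \<longleftrightarrow> U \<in> bounded_operators S \<and>
     (\<forall>f\<in>l2 S. \<forall>g\<in>l2 S. l2_inner (T f) g = l2_inner f (U g))"

lemma l2_zero [simp]: "(\<lambda>_. 0) \<in> l2 S"
  by (simp add: l2_def)

lemma l2_outside: "f \<in> l2 S \<Longrightarrow> w \<notin> S \<Longrightarrow> f w = 0"
  by (simp add: l2_def)

lemma l2_summable: "f \<in> l2 S \<Longrightarrow> (\<lambda>w. (cmod (f w))\<^sup>2) summable_on UNIV"
  by (simp add: l2_def)

lemma l2_dominated:
  assumes f: "f \<in> l2 S" and K: "K \<ge> 0" and le: "\<And>w. cmod (g w) \<le> K * cmod (f w)"
  shows "g \<in> l2 S" and "l2_norm g \<le> K * l2_norm f"
proof -
  have sq: "(cmod (g w))\<^sup>2 \<le> K\<^sup>2 * (cmod (f w))\<^sup>2" for w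
    using power_mono[OF le[of w], of 2] by (simp add: power_mult_distrib)
  have sf: "(\<lambda>w. K\<^sup>2 * (cmod (f w))\<^sup>2) summable_on UNIV"
    using l2_summable[OF f] by (rule summable_on_cmult_right)
  have sg: "(\<lambda>w. (cmod (g w))\<^sup>2) summable_on UNIV"
    by (rule summable_on_comparison_test[OF sf]) (auto simp: sq)
  have "g w = 0" if "w \<notin> S" for w
    using le[of w] l2_outside[OF f that] by simp
  with sg show "g \<in> l2 S" by (simp add: l2_def)
  have "(\<Sum>\<^sub>\<infinity>w. (cmod (g w))\<^sup>2) \<le> (\<Sum>\<^sub>\<infinity>w. K\<^sup>2 * (cmod (f w))\<^sup>2)"
    by (rule infsum_mono[OF sg sf sq])
  also have "\<dots> = K\<^sup>2 * (\<Sum>\<^sub>\<infinity>w. (cmod (f w))\<^sup>2)"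
    by (rule infsum_cmult_right) (use l2_summable[OF f] in simp)
  finally have "sqrt (\<Sum>\<^sub>\<infinity>w. (cmod (g w))\<^sup>2) \<le> sqrt (K\<^sup>2 * (\<Sum>\<^sub>\<infinity>w. (cmod (f w))\<^sup>2))"
    by (rule real_sqrt_le_mono)
  then show "l2_norm g \<le> K * l2_norm f"
    using K by (simp add: l2_norm_def real_sqrt_mult)
qed

lemma l2_norm_nonneg: "0 \<le> l2_norm f"
  by (simp add: l2_norm_def infsum_nonneg)

lemma l2_scale: "f \<in> l2 S \<Longrightarrow> (\<lambda>w. c * f w) \<in> l2 S"
  and l2_norm_scale_le: "f \<in> l2 S \<Longrightarrow> l2_norm (\<lambda>w. c * f w) \<le> cmod c * l2_norm f"
  using l2_dominated[of f S "cmod c" "\<lambda>w. c * f w"] by (simp_all add: norm_mult)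

lemma cmod_le_l2_norm:
  assumes "f \<in> l2 S" shows "cmod (f w) \<le> l2_norm f"
proof -
  have "(\<Sum>\<^sub>\<infinity>v\<in>{w}. (cmod (f v))\<^sup>2) \<le> (\<Sum>\<^sub>\<infinity>v. (cmod (f v))\<^sup>2)"
    by (rule infsum_mono_neutral) (use l2_summable[OF assms] in auto)
  then show ?thesis
    by (simp add: l2_norm_def real_le_rsqrt)
qed

text \<open>
  The crude bound \<open>|a - b|\<^sup>2 \<le> 2|a|\<^sup>2 + 2|b|\<^sup>2\<close> takes the place of the triangle inequality:
  it suffices to see that differences of bounded operators have a finite supremum in
  \<^const>\<open>op_norm\<close>.
\<close>

lemma l2_diff_bound:
  assumes f: "f \<in> l2 S" and g: "g \<in> l2 S"
  shows "l2_norm (\<lambda>w. f w - g w) \<le> sqrt (2 * ((l2_norm f)\<^sup>2 + (l2_norm g)\<^sup>2))"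
    and "(\<lambda>w. f w - g w) \<in> l2 S"
proof -
  have sq: "(cmod (f w - g w))\<^sup>2 \<le> 2 * ((cmod (f w))\<^sup>2 + (cmod (g w))\<^sup>2)" for w
  proof -
    have "(cmod (f w - g w))\<^sup>2 \<le> (cmod (f w) + cmod (g w))\<^sup>2"
      by (rule power_mono) (auto simp: norm_triangle_ineq4)
    then show ?thesis
      using sum_squares_bound[of "cmod (f w)" "cmod (g w)"] by (simp add: power2_sum)
  qed
  note sf = l2_summable[OF f] and sg = l2_summable[OF g]
  have s: "(\<lambda>w. 2 * ((cmod (f w))\<^sup>2 + (cmod (g w))\<^sup>2)) summable_on UNIV"
    by (intro summable_on_cmult_right summable_on_add sf sg)
  have sd: "(\<lambda>w. (cmod (f w - g w))\<^sup>2) summable_on UNIV"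
    by (rule summable_on_comparison_test[OF s]) (auto simp: sq[simplified])
  then show "(\<lambda>w. f w - g w) \<in> l2 S"
    using f g by (auto simp: l2_def)
  have "(\<Sum>\<^sub>\<infinity>w. (cmod (f w - g w))\<^sup>2) \<le> (\<Sum>\<^sub>\<infinity>w. 2 * ((cmod (f w))\<^sup>2 + (cmod (g w))\<^sup>2))"
    by (rule infsum_mono[OF sd s sq])
  also have "\<dots> = 2 * (\<Sum>\<^sub>\<infinity>w. (cmod (f w))\<^sup>2 + (cmod (g w))\<^sup>2)"
    by (rule infsum_cmult_right) (intro summable_on_add sf sg)
  also have "\<dots> = 2 * ((l2_norm f)\<^sup>2 + (l2_norm g)\<^sup>2)"
    by (simp add: infsum_add[OF sf sg] l2_norm_def infsum_nonneg)
  finally show "l2_norm (\<lambda>w. f w - g w) \<le> sqrt (2 * ((l2_norm f)\<^sup>2 + (l2_norm g)\<^sup>2))"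
    unfolding l2_norm_def[of "\<lambda>w. f w - g w"] by (rule real_sqrt_le_mono)
qed

lemma l2_norm_basis [simp]: "l2_norm (l2_basis w) = 1"
proof -
  have "(\<Sum>\<^sub>\<infinity>v. (cmod (l2_basis w v))\<^sup>2) = (\<Sum>\<^sub>\<infinity>v\<in>{w}. (cmod (l2_basis w v))\<^sup>2)"
    by (rule infsum_cong_neutral) (auto simp: l2_basis_def)
  then show ?thesis by (simp add: l2_norm_def l2_basis_def)
qed

lemma l2_inner_basis: "l2_inner (l2_basis w) g = cnj (g w)"
proof -
  have "l2_inner (l2_basis w) g = (\<Sum>\<^sub>\<infinity>v\<in>{w}. l2_basis w v * cnj (g v))"
    unfolding l2_inner_def by (rule infsum_cong_neutral) (auto simp: l2_basis_def)
  then show ?thesis by (simp add: l2_basis_def)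
qed

lemma bounded_operatorsD:
  assumes "T \<in> bounded_operators S"
  shows "f \<in> l2 S \<Longrightarrow> T f \<in> l2 S" "f \<notin> l2 S \<Longrightarrow> T f = (\<lambda>_. 0)"
    "f \<in> l2 S \<Longrightarrow> T (\<lambda>w. c * f w) = (\<lambda>w. c * T f w)"
  using assms by (auto simp: bounded_operators_def)

lemma bounded_operatorsI:
  assumes "\<And>f. f \<in> l2 S \<Longrightarrow> T f \<in> l2 S" "\<And>f. f \<notin> l2 S \<Longrightarrow> T f = (\<lambda>_. 0)"
    "\<And>f g. f \<in> l2 S \<Longrightarrow> g \<in> l2 S \<Longrightarrow> T (\<lambda>w. f w + g w) = (\<lambda>w. T f w + T g w)"
    "\<And>c f. f \<in> l2 S \<Longrightarrow> T (\<lambda>w. c * f w) = (\<lambda>w. c * T f w)"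
    "\<And>f. f \<in> l2 S \<Longrightarrow> l2_norm (T f) \<le> K * l2_norm f"
  shows "T \<in> bounded_operators S"
  using assms unfolding bounded_operators_def by blast

lemma l2_add: "f \<in> l2 S \<Longrightarrow> g \<in> l2 S \<Longrightarrow> (\<lambda>w. f w + g w) \<in> l2 S"
  using l2_diff_bound(2)[OF _ l2_scale[of g S "-1"]] by simp

lemma bounded_operators_bound:
  assumes "T \<in> bounded_operators S"
  shows "\<exists>K. \<forall>f\<in>l2 S. l2_norm (T f) \<le> K * l2_norm f"
  using assms by (simp add: bounded_operators_def)

text \<open>
  Testing against the basis vectors determines \<open>U g\<close> coordinatewise, so an adjoint is unique.
  Hence the description by which \<^const>\<open>op_adjoint\<close> is defined may be replaced by any explicit
  adjoint.
\<close>

lemma op_adjoint_eqI: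
  assumes U: "is_adjoint S T U" shows "op_adjoint S T = U"
proof -
  have "V = U" if V: "is_adjoint S T V" for V
  proof (rule ext)
    have Ub: "U \<in> bounded_operators S" and Vb: "V \<in> bounded_operators S"
      using U V by (simp_all add: is_adjoint_def)
    fix g show "V g = U g"
    proof (cases "g \<in> l2 S")
      case True
      show ?thesis
      proof (rule ext)
        fix w show "V g w = U g w"
        proof (cases "w \<in> S")
          case w: True
          have "l2_inner (l2_basis w) (V g) = l2_inner (l2_basis w) (U g)"
            using U V True l2_basis_in_l2[OF w] unfolding is_adjoint_def by metis
          then show ?thesis by (simp add: l2_inner_basis)
        next
          case False
          then show ?thesis
            using l2_outside[OF bounded_operatorsD(1)[OF Ub True]]
              l2_outside[OF bounded_operatorsD(1)[OF Vb True]] by simp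
        qed
      qed
    next
      case False
      then show ?thesis
        by (simp add: bounded_operatorsD(2)[OF Ub] bounded_operatorsD(2)[OF Vb])
    qed
  qed
  then show ?thesis
    unfolding op_adjoint_def is_adjoint_def[symmetric]
    by (intro the_equality U)
qed

lemma op_norm_bound:
  assumes T: "T \<in> bounded_operators S" and U: "U \<in> bounded_operators S"
    and f: "f \<in> l2 S" "l2_norm f \<le> 1"
  shows "l2_norm (op_diff T U f) \<le> op_norm S (op_diff T U)"
proof -
  obtain K where K: "\<forall>f\<in>l2 S. l2_norm (T f) \<le> K * l2_norm f"
    using bounded_operators_bound[OF T] by blast
  obtain M where M: "\<forall>f\<in>l2 S. l2_norm (U f) \<le> M * l2_norm f"
    using bounded_operators_bound[OF U] by blast
  have bd: "l2_norm (op_diff T U f) \<le> sqrt (2 * (\<bar>K\<bar>\<^sup>2 + \<bar>M\<bar>\<^sup>2))"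
    if f: "f \<in> l2 S" "l2_norm f \<le> 1" for f
  proof -
    have *: "C * l2_norm f \<le> \<bar>C\<bar>" for C
      using mult_mono[OF abs_ge_self[of C] f(2)] l2_norm_nonneg[of f] by simp
    have "l2_norm (T f) \<le> \<bar>K\<bar>" "l2_norm (U f) \<le> \<bar>M\<bar>"
      using K[rule_format, OF f(1)] M[rule_format, OF f(1)] *[of K] *[of M] by linarith+
    then have "(l2_norm (T f))\<^sup>2 \<le> \<bar>K\<bar>\<^sup>2" "(l2_norm (U f))\<^sup>2 \<le> \<bar>M\<bar>\<^sup>2"
      by (simp_all only: power_mono l2_norm_nonneg)
    moreover have "l2_norm (op_diff T U f) \<le> sqrt (2 * ((l2_norm (T f))\<^sup>2 + (l2_norm (U f))\<^sup>2))"
      unfolding op_diff_def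
      by (rule l2_diff_bound) (use T U f bounded_operatorsD(1) in blast)+
    ultimately show ?thesis
      by (elim order_trans) (simp del: power2_abs)
  qed
  show ?thesis
    unfolding op_norm_def
  proof (rule cSUP_upper2[OF _ _ order.refl])
    show "bdd_above ((\<lambda>f. l2_norm (op_diff T U f)) ` {f \<in> l2 S. l2_norm f \<le> 1})"
      using bd by (auto intro!: bdd_aboveI2)
    show "f \<in> {f \<in> l2 S. l2_norm f \<le> 1}" using f by simp
  qed
qed

text \<open>
  A single coordinate is bounded by the norm, so convergence in operator norm forces convergence of
  every coordinate of every value.
\<close>

lemma op_norm_tendsto_pointwise:
  assumes X: "\<And>n. X n \<in> bounded_operators S" and T: "T \<in> bounded_operators S"
    and lim: "(\<lambda>n. op_norm S (op_diff (X n) T)) \<longlonglongrightarrow> 0" and f: "f \<in> l2 S"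
  shows "(\<lambda>n. X n f w) \<longlonglongrightarrow> T f w"
proof -
  \<comment> \<open>The estimate by the operator norm is available on the unit ball only, so \<open>f\<close> is scaled into it.\<close>
  define c where "c = 1 / (l2_norm f + 1)"
  have c: "c > 0" using l2_norm_nonneg[of f] by (simp add: c_def)
  define g where "g = (\<lambda>w. complex_of_real c * f w)"
  have g: "g \<in> l2 S" unfolding g_def by (rule l2_scale[OF f])
  have "l2_norm g \<le> c * l2_norm f"
    using l2_norm_scale_le[OF f, of c] c by (simp add: g_def)
  also have "\<dots> \<le> 1" using l2_norm_nonneg[of f] by (simp add: c_def)
  finally have g1: "l2_norm g \<le> 1" .
  have "cmod (X n g w - T g w) \<le> op_norm S (op_diff (X n) T)" for n
  proof -
    have "op_diff (X n) T g \<in> l2 S"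
      unfolding op_diff_def using bounded_operatorsD(1)[OF X g] bounded_operatorsD(1)[OF T g]
      by (rule l2_diff_bound)
    from cmod_le_l2_norm[OF this, of w] op_norm_bound[OF X T g g1, of n]
    show ?thesis by (simp add: op_diff_def)
  qed
  then have "(\<lambda>n. X n g w - T g w) \<longlonglongrightarrow> 0"
    by (intro Lim_null_comparison[OF _ lim]) auto
  then have "(\<lambda>n. of_real (1/c) * (X n g w - T g w)) \<longlonglongrightarrow> of_real (1/c) * 0"
    by (rule tendsto_mult_left)
  moreover have "of_real (1/c) * (X n g w - T g w) = X n f w - T f w" for n
    unfolding g_def bounded_operatorsD(3)[OF X f] bounded_operatorsD(3)[OF T f]
    using c by (simp add: field_simps)
  ultimately show ?thesis by (simp add: LIM_zero_iff)
qed

section \<open>The algebra of diagonal operators\<close>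

definition diagonal :: "'w set \<Rightarrow> ('w \<Rightarrow> complex) \<Rightarrow> 'w operator" where
  "diagonal S \<phi> = (\<lambda>f w. if f \<in> l2 S then \<phi> w * f w else 0)"

definition diagonal_algebra :: "'w set \<Rightarrow> 'w operator set" where
  "diagonal_algebra S = {diagonal S \<phi> | \<phi>. bounded (range \<phi>)}"

lemma diagonal_bounded:
  assumes "bounded (range \<phi>)" shows "diagonal S \<phi> \<in> bounded_operators S"
proof -
  obtain K where K: "K > 0" "\<And>w. cmod (\<phi> w) \<le> K"
    using assms by (auto simp: bounded_pos)
  have *: "diagonal S \<phi> f \<in> l2 S" "l2_norm (diagonal S \<phi> f) \<le> K * l2_norm f" if "f \<in> l2 S" for f
  proof -
    have "cmod (diagonal S \<phi> f w) \<le> K * cmod (f w)" for w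
      using K by (auto simp: diagonal_def that norm_mult intro!: mult_right_mono)
    then show "diagonal S \<phi> f \<in> l2 S" "l2_norm (diagonal S \<phi> f) \<le> K * l2_norm f"
      using K l2_dominated[OF that, of K] by auto
  qed
  then show ?thesis
    by (intro bounded_operatorsI[where K=K])
      (simp_all add: diagonal_def l2_add l2_scale algebra_simps fun_eq_iff)
qed

lemma diagonal_adjoint:
  assumes "bounded (range \<phi>)" shows "is_adjoint S (diagonal S \<phi>) (diagonal S (\<lambda>w. cnj (\<phi> w)))"
proof -
  have "bounded (range (\<lambda>w. cnj (\<phi> w)))"
    using assms by (auto simp: bounded_iff)
  then show ?thesis
    unfolding is_adjoint_def
    by (auto simp: diagonal_bounded) (simp add: diagonal_def l2_inner_def mult_ac)
qed

lemma diagonal_algebra_adjoint: "T \<in> diagonal_algebra S \<Longrightarrow> \<exists>U. is_adjoint S T U"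
  using diagonal_adjoint by (auto simp: diagonal_algebra_def)

text \<open>
  A norm limit of diagonal operators is diagonal: its symbol \<open>\<psi>\<close> has to be the diagonal entry of
  \<open>T\<close>, it is bounded because \<open>T\<close> is, and coordinatewise convergence identifies \<open>T\<close> with
  multiplication by \<open>\<psi>\<close>.
\<close>

lemma diagonal_algebra_closed:
  assumes X: "\<And>n. X n \<in> diagonal_algebra S" and T: "T \<in> bounded_operators S"
    and lim: "(\<lambda>n. op_norm S (op_diff (X n) T)) \<longlonglongrightarrow> 0"
  shows "T \<in> diagonal_algebra S"
proof -
  obtain \<phi> where \<phi>: "\<And>n. X n = diagonal S (\<phi> n)" "\<And>n. bounded (range (\<phi> n))"
    using X unfolding diagonal_algebra_def by simp metis
  have Xb: "X n \<in> bounded_operators S" for n using \<phi> diagonal_bounded by auto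
  define \<psi> where "\<psi> w = (if w \<in> S then T (l2_basis w) w else 0)" for w
  obtain K where K: "\<forall>f\<in>l2 S. l2_norm (T f) \<le> K * l2_norm f"
    using bounded_operators_bound[OF T] by blast
  have "cmod (\<psi> w) \<le> \<bar>K\<bar>" for w
  proof (cases "w \<in> S")
    case True
    note b = l2_basis_in_l2[OF True]
    show ?thesis
      using cmod_le_l2_norm[OF bounded_operatorsD(1)[OF T b], of w] K[rule_format, OF b] True
      by (simp add: \<psi>_def)
  qed (simp add: \<psi>_def)
  then have bd: "bounded (range \<psi>)" by (auto simp: bounded_iff)
  have "T f w = \<psi> w * f w" if f: "f \<in> l2 S" for f w
  proof (cases "w \<in> S")
    case True
    note b = l2_basis_in_l2[OF True]
    have "(\<lambda>n. \<phi> n w) \<longlonglongrightarrow> \<psi> w"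
      using op_norm_tendsto_pointwise[OF Xb T lim b, of w] True b
      by (simp add: \<psi>_def \<phi> diagonal_def l2_basis_def)
    then have "(\<lambda>n. \<phi> n w * f w) \<longlonglongrightarrow> \<psi> w * f w"
      by (rule tendsto_mult_right)
    moreover have "(\<lambda>n. \<phi> n w * f w) \<longlonglongrightarrow> T f w"
      using op_norm_tendsto_pointwise[OF Xb T lim f, of w] by (simp add: \<phi> diagonal_def f)
    ultimately show ?thesis by (rule LIMSEQ_unique[symmetric])
  next
    case False
    then show ?thesis
      using l2_outside[OF bounded_operatorsD(1)[OF T f]] by (simp add: \<psi>_def)
  qed
  then have "T = diagonal S \<psi>"
    using bounded_operatorsD(2)[OF T] by (auto simp: diagonal_def fun_eq_iff)
  with bd show ?thesis by (auto simp: diagonal_algebra_def)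
qed

lemma diagonal_algebra_concrete: "concrete_cstar_algebra S (diagonal_algebra S)"
proof -
  have bplus: "bounded (range (\<lambda>w. \<phi> w + \<psi> w))" and bmult: "bounded (range (\<lambda>w. \<phi> w * \<psi> w))"
    if "bounded (range \<phi>)" "bounded (range \<psi>)" for \<phi> \<psi> :: "'a \<Rightarrow> complex"
  proof -
    have "\<exists>K. \<forall>w. cmod (\<phi> w) \<le> K" "\<exists>M. \<forall>w. cmod (\<psi> w) \<le> M"
      using that by (simp_all add: bounded_iff)
    then obtain K M where *: "\<And>w. cmod (\<phi> w) \<le> K" "\<And>w. cmod (\<psi> w) \<le> M" by metis
    have "cmod (\<phi> w + \<psi> w) \<le> K + M" for w using * by (meson add_mono norm_triangle_le)
    moreover have "cmod (\<phi> w * \<psi> w) \<le> K * M" for w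
      unfolding norm_mult using *[of w] by (meson mult_mono norm_ge_zero order_trans)
    ultimately show "bounded (range (\<lambda>w. \<phi> w + \<psi> w))" "bounded (range (\<lambda>w. \<phi> w * \<psi> w))"
      by (auto simp: bounded_iff)
  qed
  have l2d: "(\<lambda>w. \<phi> w * f w) \<in> l2 S" if "bounded (range \<phi>)" "f \<in> l2 S" for \<phi> f
    using bounded_operatorsD(1)[OF diagonal_bounded[OF that(1)] that(2)] that(2)
    by (simp add: diagonal_def)
  have memI: "T \<in> diagonal_algebra S" if "T = diagonal S \<phi>" "bounded (range \<phi>)" for T \<phi>
    using that by (auto simp: diagonal_algebra_def)
  have zero: "(\<lambda>_ _. 0) \<in> diagonal_algebra S"
    by (rule memI[of _ "\<lambda>_. 0"]) (auto simp: diagonal_def fun_eq_iff)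
  have add: "op_add (diagonal S \<phi>) (diagonal S \<psi>) \<in> diagonal_algebra S"
    if "bounded (range \<phi>)" "bounded (range \<psi>)" for \<phi> \<psi>
    by (rule memI[OF _ bplus[OF that]]) (auto simp: diagonal_def op_add_def algebra_simps fun_eq_iff)
  have comp: "diagonal S \<phi> \<circ> diagonal S \<psi> \<in> diagonal_algebra S"
    if "bounded (range \<phi>)" "bounded (range \<psi>)" for \<phi> \<psi>
    by (rule memI[OF _ bmult[OF that]]) (simp add: diagonal_def fun_eq_iff l2d[OF that(2)])
  have scale: "op_scale c (diagonal S \<phi>) \<in> diagonal_algebra S" if "bounded (range \<phi>)" for c \<phi>
    by (rule memI[OF _ bmult[OF _ that, of "\<lambda>_. c"]]) (auto simp: diagonal_def op_scale_def fun_eq_iff)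
  have adj: "op_adjoint S (diagonal S \<phi>) \<in> diagonal_algebra S" if "bounded (range \<phi>)" for \<phi>
    unfolding op_adjoint_eqI[OF diagonal_adjoint[OF that]]
    by (rule memI[OF refl]) (use that in \<open>auto simp: bounded_iff\<close>)
  have rep: "\<exists>\<phi>. T = diagonal S \<phi> \<and> bounded (range \<phi>)" if "T \<in> diagonal_algebra S" for T
    using that by (auto simp: diagonal_algebra_def)
  show ?thesis
    unfolding concrete_cstar_algebra_def
  proof (intro conjI ballI allI impI)
    show "diagonal_algebra S \<subseteq> bounded_operators S"
      using diagonal_bounded by (auto simp: diagonal_algebra_def)
    show "op_add T U \<in> diagonal_algebra S" "T \<circ> U \<in> diagonal_algebra S"
      if "T \<in> diagonal_algebra S" "U \<in> diagonal_algebra S" for T U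
      using add comp rep[OF that(1)] rep[OF that(2)] by blast+
    show "op_scale c T \<in> diagonal_algebra S" "op_adjoint S T \<in> diagonal_algebra S"
      if "T \<in> diagonal_algebra S" for c T
      using scale adj rep[OF that] by blast+
  qed (use zero diagonal_algebra_closed in auto)
qed

lemma concrete_cstar_algebraD:
  assumes "concrete_cstar_algebra S \<A>"
  shows "\<A> \<subseteq> bounded_operators S" "(\<lambda>_ _. 0) \<in> \<A>"
    "T \<in> \<A> \<Longrightarrow> U \<in> \<A> \<Longrightarrow> op_add T U \<in> \<A>" "T \<in> \<A> \<Longrightarrow> U \<in> \<A> \<Longrightarrow> T \<circ> U \<in> \<A>"
    "T \<in> \<A> \<Longrightarrow> op_scale c T \<in> \<A>" "T \<in> \<A> \<Longrightarrow> op_adjoint S T \<in> \<A>"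
    "(\<And>n. X n \<in> \<A>) \<Longrightarrow> T \<in> bounded_operators S \<Longrightarrow>
      (\<lambda>n. op_norm S (op_diff (X n) T)) \<longlonglongrightarrow> 0 \<Longrightarrow> T \<in> \<A>"
  using assms unfolding concrete_cstar_algebra_def by (simp_all only: simp_thms) (elim conjE allE[of _ X] allE[of _ T], simp)

lemma concrete_cstar_algebraI:
  assumes "\<A> \<subseteq> bounded_operators S" "(\<lambda>_ _. 0) \<in> \<A>"
    "\<And>T U. T \<in> \<A> \<Longrightarrow> U \<in> \<A> \<Longrightarrow> op_add T U \<in> \<A>" "\<And>T U. T \<in> \<A> \<Longrightarrow> U \<in> \<A> \<Longrightarrow> T \<circ> U \<in> \<A>"
    "\<And>c T. T \<in> \<A> \<Longrightarrow> op_scale c T \<in> \<A>" "\<And>T. T \<in> \<A> \<Longrightarrow> op_adjoint S T \<in> \<A>"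
    "\<And>X T. (\<And>n::nat. X n \<in> \<A>) \<Longrightarrow> T \<in> bounded_operators S \<Longrightarrow>
      (\<lambda>n. op_norm S (op_diff (X n) T)) \<longlonglongrightarrow> 0 \<Longrightarrow> T \<in> \<A>"
  shows "concrete_cstar_algebra S \<A>"
proof -
  have "\<forall>X T. (\<forall>n::nat. X n \<in> \<A>) \<and> T \<in> bounded_operators S \<and>
      (\<lambda>n. op_norm S (op_diff (X n) T)) \<longlonglongrightarrow> 0 \<longrightarrow> T \<in> \<A>"
    using assms(7) by blast
  with assms(1-6) show ?thesis
    unfolding concrete_cstar_algebra_def by (intro conjI) simp_all
qed

text \<open>
  The generated algebra is an intersection of algebras. It is an algebra of bounded operators only
  if some algebra contains the generators; for the families considered here the diagonal operators
  are such an algebra.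
\<close>

lemma concrete_cstar_algebra_Inter:
  assumes ne: "\<C> \<noteq> {}" and \<C>: "\<And>\<A>. \<A> \<in> \<C> \<Longrightarrow> concrete_cstar_algebra S \<A>"
  shows "concrete_cstar_algebra S (\<Inter>\<C>)"
proof (rule concrete_cstar_algebraI)
  show "\<Inter>\<C> \<subseteq> bounded_operators S"
    using ne concrete_cstar_algebraD(1)[OF \<C>] by blast
  show "T \<in> \<Inter>\<C>" if "\<And>n::nat. X n \<in> \<Inter>\<C>" "T \<in> bounded_operators S"
    "(\<lambda>n. op_norm S (op_diff (X n) T)) \<longlonglongrightarrow> 0" for X T
    using that(1) by (intro InterI concrete_cstar_algebraD(7)[OF \<C> _ that(2,3)]) auto
qed (auto intro: concrete_cstar_algebraD[OF \<C>])

lemma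
  assumes "G \<subseteq> diagonal_algebra S"
  shows cstar_generated_concrete: "concrete_cstar_algebra S (cstar_generated S G)"
    and cstar_generated_diagonal: "cstar_generated S G \<subseteq> diagonal_algebra S"
proof -
  show "concrete_cstar_algebra S (cstar_generated S G)"
    unfolding cstar_generated_def hull_def
    by (rule concrete_cstar_algebra_Inter) (use assms diagonal_algebra_concrete in auto)
  show "cstar_generated S G \<subseteq> diagonal_algebra S"
    unfolding cstar_generated_def
    by (rule hull_minimal[where S="concrete_cstar_algebra S", OF assms diagonal_algebra_concrete])
qed

section \<open>Change of the index set\<close>

text \<open>
  The identification of \<open>\<ell>\<^sup>2(S)\<close> with \<open>\<ell>\<^sup>2(\<rho>(S))\<close> along a bijection \<open>\<rho>\<close> of the index types is
  unitary, and this is conjugation by it.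
\<close>

definition transport :: "('v \<Rightarrow> 'w) \<Rightarrow> 'v operator \<Rightarrow> 'w operator" where
  "transport \<rho> T = (\<lambda>f w. T (f \<circ> \<rho>) (inv \<rho> w))"

lemma transport_inv: "bij \<rho> \<Longrightarrow> transport (inv \<rho>) (transport \<rho> T) = T"
  by (simp add: transport_def fun_eq_iff o_def bij_is_surj bij_is_inj inv_inv_eq)

lemma transport_inv': "bij \<rho> \<Longrightarrow> transport \<rho> (transport (inv \<rho>) T) = T"
  using transport_inv[of "inv \<rho>" T] by (simp add: bij_imp_bij_inv inv_inv_eq)

lemma l2_reindex:
  assumes "bij \<rho>" shows "f \<in> l2 (\<rho> ` S) \<longleftrightarrow> f \<circ> \<rho> \<in> l2 S"
proof -
  have "(\<lambda>v. (cmod (f v))\<^sup>2) summable_on UNIV \<longleftrightarrow> (\<lambda>v. (cmod (f (\<rho> v)))\<^sup>2) summable_on UNIV"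
    using summable_on_reindex_bij_betw[OF assms, of "\<lambda>v. (cmod (f v))\<^sup>2"] by simp
  moreover have "(\<forall>w. w \<notin> \<rho> ` S \<longrightarrow> f w = 0) \<longleftrightarrow> (\<forall>v. v \<notin> S \<longrightarrow> f (\<rho> v) = 0)"
    using assms by (metis bij_is_inj bij_pointE image_iff inj_image_mem_iff)
  ultimately show ?thesis by (simp add: l2_def)
qed

lemma l2_norm_reindex: "bij \<rho> \<Longrightarrow> l2_norm (f \<circ> \<rho>) = l2_norm f"
  unfolding l2_norm_def
  using infsum_reindex_bij_betw[of \<rho> UNIV UNIV "\<lambda>v. (cmod (f v))\<^sup>2"] by simp

lemma l2_inner_reindex: "bij \<rho> \<Longrightarrow> l2_inner (f \<circ> \<rho>) (g \<circ> \<rho>) = l2_inner f g"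
  unfolding l2_inner_def
  using infsum_reindex_bij_betw[of \<rho> UNIV UNIV "\<lambda>v. f v * cnj (g v)"] by simp

lemma transport_comp_reindex: "bij \<rho> \<Longrightarrow> transport \<rho> T f \<circ> \<rho> = T (f \<circ> \<rho>)"
  by (simp add: transport_def fun_eq_iff bij_is_inj)

lemma transport_comp: "bij \<rho> \<Longrightarrow> transport \<rho> (T \<circ> U) = transport \<rho> T \<circ> transport \<rho> U"
  by (simp add: fun_eq_iff transport_comp_reindex transport_def[of _ "T \<circ> U"] transport_def[of _ T])

lemma transport_add: "transport \<rho> (op_add T U) = op_add (transport \<rho> T) (transport \<rho> U)"
  and transport_diff: "transport \<rho> (op_diff T U) = op_diff (transport \<rho> T) (transport \<rho> U)"
  and transport_scale: "transport \<rho> (op_scale c T) = op_scale c (transport \<rho> T)"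
  and transport_zero: "transport \<rho> (\<lambda>_ _. 0) = (\<lambda>_ _. 0)"
  by (simp_all add: transport_def op_add_def op_diff_def op_scale_def)

lemma transport_bounded:
  assumes \<rho>: "bij \<rho>" and T: "T \<in> bounded_operators S"
  shows "transport \<rho> T \<in> bounded_operators (\<rho> ` S)"
proof -
  note cr = transport_comp_reindex[OF \<rho>]
  obtain K where K: "\<forall>f\<in>l2 S. l2_norm (T f) \<le> K * l2_norm f"
    using bounded_operators_bound[OF T] by blast
  have "l2_norm (transport \<rho> T f) \<le> K * l2_norm f" if "f \<in> l2 (\<rho> ` S)" for f
    using K[rule_format, of "f \<circ> \<rho>"] that l2_norm_reindex[OF \<rho>, of "transport \<rho> T f"]
    by (simp add: l2_reindex[OF \<rho>] cr l2_norm_reindex[OF \<rho>])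
  moreover have "T (\<lambda>w. f w + g w) = (\<lambda>w. T f w + T g w)" if "f \<in> l2 S" "g \<in> l2 S" for f g
    using T that by (simp add: bounded_operators_def)
  ultimately show ?thesis
    using bounded_operatorsD[OF T]
    by (intro bounded_operatorsI[where K=K])
       (auto simp: l2_reindex[OF \<rho>] cr, auto simp: transport_def o_def fun_eq_iff)
qed

lemma transport_op_norm:
  assumes \<rho>: "bij \<rho>" shows "op_norm (\<rho> ` S) (transport \<rho> T) = op_norm S T"
proof -
  have "{f \<in> l2 S. l2_norm f \<le> 1} = (\<lambda>f. f \<circ> \<rho>) ` {f \<in> l2 (\<rho> ` S). l2_norm f \<le> 1}"
  proof (intro subset_antisym subsetI)
    fix f assume f: "f \<in> {f \<in> l2 S. l2_norm f \<le> 1}"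
    have "f = (f \<circ> inv \<rho>) \<circ> \<rho>" using \<rho> by (simp add: fun_eq_iff bij_is_inj)
    with f show "f \<in> (\<lambda>f. f \<circ> \<rho>) ` {f \<in> l2 (\<rho> ` S). l2_norm f \<le> 1}"
      using l2_reindex[OF \<rho>, of "f \<circ> inv \<rho>" S] l2_norm_reindex[OF \<rho>, of "f \<circ> inv \<rho>"]
      by (intro image_eqI[of _ _ "f \<circ> inv \<rho>"]) auto
  qed (auto simp: l2_reindex[OF \<rho>] l2_norm_reindex[OF \<rho>])
  moreover have "l2_norm (T (f \<circ> \<rho>)) = l2_norm (transport \<rho> T f)" for f
    by (metis \<rho> l2_norm_reindex transport_comp_reindex)
  ultimately show ?thesis by (simp add: op_norm_def image_image)
qed

lemma transport_is_adjoint: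
  assumes \<rho>: "bij \<rho>" and U: "is_adjoint S T U"
  shows "is_adjoint (\<rho> ` S) (transport \<rho> T) (transport \<rho> U)"
  unfolding is_adjoint_def
proof (intro conjI ballI)
  show "transport \<rho> U \<in> bounded_operators (\<rho> ` S)"
    using U by (simp add: is_adjoint_def transport_bounded[OF \<rho>])
  fix f g assume "f \<in> l2 (\<rho> ` S)" "g \<in> l2 (\<rho> ` S)"
  then have "l2_inner (T (f \<circ> \<rho>)) (g \<circ> \<rho>) = l2_inner (f \<circ> \<rho>) (U (g \<circ> \<rho>))"
    using U by (simp add: is_adjoint_def l2_reindex[OF \<rho>])
  then show "l2_inner (transport \<rho> T f) g = l2_inner f (transport \<rho> U g)"
    by (simp only: transport_comp_reindex[OF \<rho>, symmetric] l2_inner_reindex[OF \<rho>])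
qed

lemma transport_adjoint:
  assumes "bij \<rho>" "is_adjoint S T U"
  shows "op_adjoint (\<rho> ` S) (transport \<rho> T) = transport \<rho> (op_adjoint S T)"
  using op_adjoint_eqI[OF transport_is_adjoint[OF assms]] op_adjoint_eqI[OF assms(2)] by simp

text \<open>
  Conjugation by a unitary respects every operation of a concrete C*-algebra. For the adjoint this
  follows from uniqueness once an adjoint exists, and on diagonal operators the conjugate symbol
  provides one.
\<close>

lemma transport_concrete:
  assumes \<rho>: "bij \<rho>" and \<A>: "concrete_cstar_algebra S \<A>" "\<A> \<subseteq> diagonal_algebra S"
  shows "concrete_cstar_algebra (\<rho> ` S) (transport \<rho> ` \<A>)"
proof (rule concrete_cstar_algebraI)
  note D = concrete_cstar_algebraD[OF \<A>(1)]
  show "transport \<rho> ` \<A> \<subseteq> bounded_operators (\<rho> ` S)"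
    using D(1) transport_bounded[OF \<rho>] by auto
  show "(\<lambda>_ _. 0) \<in> transport \<rho> ` \<A>"
    using D(2) transport_zero[of \<rho>] by (metis imageI)
  show "op_add T U \<in> transport \<rho> ` \<A>" "T \<circ> U \<in> transport \<rho> ` \<A>"
    if "T \<in> transport \<rho> ` \<A>" "U \<in> transport \<rho> ` \<A>" for T U
    using that by (auto simp: transport_add[symmetric] transport_comp[OF \<rho>, symmetric] D)
  show "op_scale c T \<in> transport \<rho> ` \<A>" if "T \<in> transport \<rho> ` \<A>" for c T
    using that by (auto simp: transport_scale[symmetric] D)
  show "op_adjoint (\<rho> ` S) T \<in> transport \<rho> ` \<A>" if T: "T \<in> transport \<rho> ` \<A>" for T
  proof -
    obtain T' where T': "T' \<in> \<A>" "T = transport \<rho> T'" using T by auto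
    then obtain U where "is_adjoint S T' U"
      using \<A>(2) diagonal_algebra_adjoint by blast
    then show ?thesis using T' transport_adjoint[OF \<rho>] D(6) by auto
  qed
  show "T \<in> transport \<rho> ` \<A>"
    if X: "\<And>n::nat. X n \<in> transport \<rho> ` \<A>" and T: "T \<in> bounded_operators (\<rho> ` S)"
      and lim: "(\<lambda>n. op_norm (\<rho> ` S) (op_diff (X n) T)) \<longlonglongrightarrow> 0" for X T
  proof -
    define Y where "Y n = transport (inv \<rho>) (X n)" for n
    define U where "U = transport (inv \<rho>) T"
    have XY: "X n = transport \<rho> (Y n)" for n by (simp add: Y_def transport_inv'[OF \<rho>])
    have TU: "T = transport \<rho> U" by (simp add: U_def transport_inv'[OF \<rho>])
    have "Y n \<in> \<A>" for n using X[of n] by (auto simp: Y_def transport_inv[OF \<rho>])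
    moreover have "U \<in> bounded_operators S"
      using transport_bounded[OF bij_imp_bij_inv[OF \<rho>] T] \<rho>
      by (simp add: U_def image_image bij_is_inj)
    moreover have "(\<lambda>n. op_norm S (op_diff (Y n) U)) \<longlonglongrightarrow> 0"
      using lim by (simp add: XY TU transport_diff[symmetric] transport_op_norm[OF \<rho>])
    ultimately have "U \<in> \<A>" by (rule D(7))
    then show ?thesis by (simp add: TU)
  qed
qed

lemma transport_generated_subset:
  assumes \<rho>: "bij \<rho>" and G: "G \<subseteq> diagonal_algebra S"
  shows "cstar_generated (\<rho> ` S) (transport \<rho> ` G) \<subseteq> transport \<rho> ` cstar_generated S G"
  unfolding cstar_generated_def[of "\<rho> ` S"]
proof (rule hull_minimal)
  show "transport \<rho> ` G \<subseteq> transport \<rho> ` cstar_generated S G"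
    unfolding cstar_generated_def by (intro image_mono hull_subset)
  show "concrete_cstar_algebra (\<rho> ` S) (transport \<rho> ` cstar_generated S G)"
    by (intro transport_concrete \<rho> cstar_generated_concrete cstar_generated_diagonal G)
qed

text \<open>
  The two inclusions are instances of the previous lemma for \<open>\<rho>\<close> and for its inverse.
\<close>

lemma transport_generated:
  assumes \<rho>: "bij \<rho>" and G: "G \<subseteq> diagonal_algebra S"
    and H: "transport \<rho> ` G \<subseteq> diagonal_algebra (\<rho> ` S)"
  shows "transport \<rho> ` cstar_generated S G = cstar_generated (\<rho> ` S) (transport \<rho> ` G)"
proof -
  have "cstar_generated S G = cstar_generated (inv \<rho> ` \<rho> ` S) (transport (inv \<rho>) ` transport \<rho> ` G)"
    using \<rho> by (simp add: image_image bij_is_inj transport_inv)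
  also have "\<dots> \<subseteq> transport (inv \<rho>) ` cstar_generated (\<rho> ` S) (transport \<rho> ` G)"
    by (rule transport_generated_subset[OF bij_imp_bij_inv[OF \<rho>] H])
  finally have "transport \<rho> ` cstar_generated S G
      \<subseteq> transport \<rho> ` transport (inv \<rho>) ` cstar_generated (\<rho> ` S) (transport \<rho> ` G)"
    by (rule image_mono)
  also have "\<dots> = cstar_generated (\<rho> ` S) (transport \<rho> ` G)"
    using \<rho> by (simp add: image_image transport_inv')
  finally show ?thesis using transport_generated_subset[OF \<rho> G] by blast
qed

section \<open>Creation operators and their initial projections\<close>

definition factor_closed :: "'a list set \<Rightarrow> bool" where
  "factor_closed L \<longleftrightarrow> (\<forall>u v w. u @ v @ w \<in> L \<longrightarrow> v \<in> L)"

lemma factor_closed_prefix: "factor_closed L \<Longrightarrow> u @ v \<in> L \<Longrightarrow> u \<in> L"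
  and factor_closed_suffix: "factor_closed L \<Longrightarrow> u @ v \<in> L \<Longrightarrow> v \<in> L"
  unfolding factor_closed_def by (metis append_Nil) (metis append_Nil2)

text \<open>
  The partial isometry attached to a partial injection \<open>\<theta>\<close> of the index set with domain \<open>D\<close>. The
  creation operators and their adjoints are all of this kind, so boundedness and adjoints need to be
  treated once only.
\<close>

definition pullback :: "'w set \<Rightarrow> 'w set \<Rightarrow> ('w \<Rightarrow> 'w) \<Rightarrow> 'w operator" where
  "pullback S D \<theta> = (\<lambda>f w. if f \<in> l2 S \<and> w \<in> D then f (\<theta> w) else 0)"

lemma
  assumes inj: "inj_on \<theta> D" and D: "D \<subseteq> S" and f: "f \<in> l2 S"
  shows pullback_l2: "pullback S D \<theta> f \<in> l2 S"
    and pullback_norm: "l2_norm (pullback S D \<theta> f) \<le> l2_norm f"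
proof -
  let ?h = "\<lambda>v. (cmod (f v))\<^sup>2"
  let ?p = "\<lambda>w. (cmod (pullback S D \<theta> f w))\<^sup>2"
  have sE: "?h summable_on \<theta> ` D"
    by (rule summable_on_subset_banach[OF l2_summable[OF f]]) simp
  have "?p summable_on UNIV \<longleftrightarrow> (?h \<circ> \<theta>) summable_on D"
    by (rule summable_on_cong_neutral) (auto simp: pullback_def f)
  also have "\<dots> \<longleftrightarrow> ?h summable_on \<theta> ` D"
    by (rule summable_on_reindex[OF inj, symmetric])
  finally show "pullback S D \<theta> f \<in> l2 S"
    using sE D by (auto simp: l2_def pullback_def)
  have "infsum ?p UNIV = infsum (?h \<circ> \<theta>) D"
    by (rule infsum_cong_neutral) (auto simp: pullback_def f)
  also have "\<dots> = infsum ?h (\<theta> ` D)"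
    by (rule infsum_reindex[OF inj, symmetric])
  also have "\<dots> \<le> infsum ?h UNIV"
    by (rule infsum_mono_neutral[OF sE l2_summable[OF f]]) auto
  finally show "l2_norm (pullback S D \<theta> f) \<le> l2_norm f"
    by (simp add: l2_norm_def)
qed

lemma pullback_bounded:
  assumes "inj_on \<theta> D" "D \<subseteq> S" shows "pullback S D \<theta> \<in> bounded_operators S"
  by (rule bounded_operatorsI[where K=1])
    (simp_all add: pullback_l2[OF assms] pullback_norm[OF assms],
     auto simp: pullback_def fun_eq_iff l2_add l2_scale)

text \<open>
  The adjoint belongs to the inverse partial injection \<open>\<kappa>\<close>; both inner products are the same sum,
  indexed by the domain in one case and by the range in the other.
\<close>

lemma pullback_adjoint:
  assumes \<kappa>: "\<And>w. w \<in> D \<Longrightarrow> \<kappa> (\<theta> w) = w" and E: "\<theta> ` D = E" "E \<subseteq> S" and D: "D \<subseteq> S"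
  shows "is_adjoint S (pullback S D \<theta>) (pullback S E \<kappa>)"
  unfolding is_adjoint_def
proof (intro conjI ballI)
  have inj\<kappa>: "inj_on \<kappa> E" and inj: "inj_on \<theta> D"
    using \<kappa> by (auto simp: inj_on_def E(1)[symmetric]) metis
  then show "pullback S E \<kappa> \<in> bounded_operators S"
    using E by (intro pullback_bounded)
  fix f g assume f: "f \<in> l2 S" and g: "g \<in> l2 S"
  let ?k = "\<lambda>v. f v * cnj (g (\<kappa> v))"
  have "l2_inner (pullback S D \<theta> f) g = infsum (?k \<circ> \<theta>) D"
    unfolding l2_inner_def by (rule infsum_cong_neutral) (auto simp: pullback_def f \<kappa>)
  also have "\<dots> = infsum ?k E"
    unfolding E(1)[symmetric] by (rule infsum_reindex[OF inj, symmetric])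
  also have "\<dots> = l2_inner f (pullback S E \<kappa> g)"
    unfolding l2_inner_def by (rule infsum_cong_neutral) (auto simp: pullback_def g)
  finally show "l2_inner (pullback S D \<theta> f) g = l2_inner f (pullback S E \<kappa> g)" .
qed

text \<open>
  \<open>T\<^sub>\<mu>\<close> is computed letter by letter, and \<open>T\<^sub>\<mu> e\<^sub>\<nu>\<close> vanishes as soon as some suffix of \<open>\<mu>\<nu>\<close> leaves
  \<open>L\<close>. Closure under suffixes makes this equivalent to \<open>\<mu>\<nu> \<notin> L\<close>.
\<close>

lemma creation_word_pullback:
  assumes L: "factor_closed L"
  shows "creation_word L \<mu> = pullback L (L \<inter> range ((@) \<mu>)) (drop (length \<mu>))"
proof (induction \<mu>)
  case Nil
  show ?case by (auto simp: fun_eq_iff op_id_def pullback_def l2_outside)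
next
  case (Cons i \<mu>)
  have inj: "inj_on (drop (length \<mu>)) (L \<inter> range ((@) \<mu>))"
    by (auto simp: inj_on_def)
  have l2: "pullback L (L \<inter> range ((@) \<mu>)) (drop (length \<mu>)) f \<in> l2 L" if "f \<in> l2 L" for f
    using inj that by (intro pullback_l2) auto
  have "i # \<mu> @ v \<in> L \<Longrightarrow> \<mu> @ v \<in> L" for v
    using factor_closed_suffix[OF L, of "[i]" "\<mu> @ v"] by simp
  then have "creation L i (pullback L (L \<inter> range ((@) \<mu>)) (drop (length \<mu>)) f) w =
      pullback L (L \<inter> range ((@) (i # \<mu>))) (drop (length (i # \<mu>))) f w" for f w
    by (cases "f \<in> l2 L"; cases w)
       (simp_all add: creation_def l2, auto simp: pullback_def)
  then show ?case by (auto simp: Cons.IH fun_eq_iff)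
qed

lemma creation_word_singleton: "creation_word L [i] = creation L i"
  by (auto simp: fun_eq_iff op_id_def creation_def)

lemma creation_word_adjoint:
  assumes L: "factor_closed L"
  shows "is_adjoint L (creation_word L \<mu>) (pullback L {v. \<mu> @ v \<in> L} ((@) \<mu>))"
  unfolding creation_word_pullback[OF L]
proof (rule pullback_adjoint)
  have "v \<in> drop (length \<mu>) ` (L \<inter> range ((@) \<mu>))" if "\<mu> @ v \<in> L" for v
    using that by (intro image_eqI[of _ _ "\<mu> @ v"]) auto
  then show "drop (length \<mu>) ` (L \<inter> range ((@) \<mu>)) = {v. \<mu> @ v \<in> L}" by auto
qed (use factor_closed_suffix[OF L] in auto)

text \<open>
  The projection onto the span of the \<open>e\<^sub>\<nu>\<close> for which \<open>\<nu>\<close> may follow \<open>\<mu>\<close>. By the next lemma it is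
  \<open>T\<^sub>\<mu>\<^sup>*T\<^sub>\<mu>\<close>; the words \<open>\<mu> \<notin> L\<close> are admitted as well and give \<open>0\<close>.
\<close>

definition follower_projection :: "'a list set \<Rightarrow> 'a list \<Rightarrow> 'a list operator" where
  "follower_projection L \<mu> = diagonal L (\<lambda>\<nu>. if \<mu> @ \<nu> \<in> L then 1 else 0)"

lemma initial_projection:
  assumes L: "factor_closed L"
  shows "op_adjoint L (creation_word L \<mu>) \<circ> creation_word L \<mu> = follower_projection L \<mu>"
proof (rule ext)
  fix f
  have l2: "creation_word L \<mu> f \<in> l2 L" if "f \<in> l2 L"
    unfolding creation_word_pullback[OF L]
    by (rule pullback_l2[OF _ _ that]) (auto simp: inj_on_def)
  have adj: "op_adjoint L (creation_word L \<mu>) = pullback L {v. \<mu> @ v \<in> L} ((@) \<mu>)"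
    by (rule op_adjoint_eqI[OF creation_word_adjoint[OF L]])
  have cw: "creation_word L \<mu> f (\<mu> @ v) = (if f \<in> l2 L \<and> \<mu> @ v \<in> L then f v else 0)" for v
    by (simp add: creation_word_pullback[OF L] pullback_def)
  show "(op_adjoint L (creation_word L \<mu>) \<circ> creation_word L \<mu>) f = follower_projection L \<mu> f"
    unfolding adj
    by (auto simp: fun_eq_iff follower_projection_def diagonal_def pullback_def cw dest: l2)
qed

text \<open>
  The key identity \<open>\<alpha>\<^sub>i(T\<^sub>\<mu>\<^sup>*T\<^sub>\<mu>) = T\<^bsub>\<mu>i\<^esub>\<^sup>*T\<^bsub>\<mu>i\<^esub>\<close>: the maps \<open>\<alpha>\<^sub>i\<close> append letters, so iterating
  them on the unit produces the projections of all words.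
\<close>

lemma quantised_map_follower_projection:
  assumes L: "factor_closed L"
  shows "op_adjoint L (creation L i) \<circ> follower_projection L \<mu> \<circ> creation L i
    = follower_projection L (\<mu> @ [i])"
proof (rule ext)
  fix f
  have "creation L i f \<in> l2 L" if "f \<in> l2 L"
    unfolding creation_word_singleton[symmetric] creation_word_pullback[OF L]
    by (rule pullback_l2[OF _ _ that]) (auto simp: inj_on_def)
  moreover have "follower_projection L \<mu> g \<in> l2 L" if "g \<in> l2 L" for g
    unfolding follower_projection_def
    by (rule bounded_operatorsD(1)[OF diagonal_bounded that]) (auto simp: bounded_iff)
  moreover have "[i] @ v \<in> L" if "\<mu> @ i # v \<in> L" for v
    using factor_closed_suffix[OF L, of \<mu> "i # v"] that by simp
  moreover have "op_adjoint L (creation L i) = pullback L {v. [i] @ v \<in> L} ((@) [i])"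
    unfolding creation_word_singleton[symmetric] by (rule op_adjoint_eqI[OF creation_word_adjoint[OF L]])
  ultimately show "(op_adjoint L (creation L i) \<circ> follower_projection L \<mu> \<circ> creation L i) f
      = follower_projection L (\<mu> @ [i]) f"
    by (cases "f \<in> l2 L")
       (auto simp: fun_eq_iff pullback_def creation_def follower_projection_def diagonal_def)
qed

text \<open>
  For \<open>\<mu> \<in> L\<close> the projection fixes the vacuum vector \<open>e\<^sub>\<emptyset>\<close>; for \<open>\<mu> \<notin> L\<close> no word can follow \<open>\<mu>\<close>.
  Membership in \<open>L\<close> can thus be read off inside the algebra.
\<close>

lemma follower_projection_eq_0_iff:
  assumes L: "factor_closed L"
  shows "follower_projection L \<mu> = (\<lambda>_ _. 0) \<longleftrightarrow> \<mu> \<notin> L"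
proof
  assume "follower_projection L \<mu> = (\<lambda>_ _. 0)"
  then have 0: "follower_projection L \<mu> (l2_basis []) [] = 0" by simp
  show "\<mu> \<notin> L"
  proof
    assume \<mu>: "\<mu> \<in> L"
    then have "[] \<in> L" using factor_closed_prefix[OF L, of "[]" \<mu>] by simp
    then have "l2_basis [] \<in> l2 L" by (rule l2_basis_in_l2)
    moreover have "l2_basis ([] :: 'a list) [] = 1" by (simp add: l2_basis_def)
    ultimately show False
      using 0 \<mu> by (simp add: follower_projection_def diagonal_def)
  qed
next
  assume "\<mu> \<notin> L"
  then show "follower_projection L \<mu> = (\<lambda>_ _. 0)"
    using factor_closed_prefix[OF L, of \<mu>] by (auto simp: follower_projection_def diagonal_def fun_eq_iff)
qed

section \<open>Conjugacy in terms of allowed words\<close>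

text \<open>
  The algebra and the maps of the quantised dynamics depend on the ideal through the set \<open>L\<close> of
  allowed words only; they are named here as functions of \<open>L\<close>.
\<close>

definition dynamics_algebra :: "'a list set \<Rightarrow> 'a list operator set" where
  "dynamics_algebra L = cstar_generated L (follower_projection L ` L)"

definition dynamics_map :: "'a list set \<Rightarrow> 'a \<Rightarrow> 'a list operator \<Rightarrow> 'a list operator" where
  "dynamics_map L i a = op_adjoint L (creation L i) \<circ> a \<circ> creation L i"

lemma quantised_dynamics_conv:
  fixes I :: "'a ncpoly set"
  defines "L \<equiv> allowed_words I"
  assumes "factor_closed L"
  shows "quantised_dynamics I =
    (\<lparr> sa_carrier = dynamics_algebra L, sa_add = op_add, sa_scale = op_scale, sa_mult = (\<circ>),
       sa_star = op_adjoint L \<rparr>, dynamics_map L)"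
  using assms(2) unfolding L_def
  by (simp add: quantised_dynamics_def quantised_algebra_def dynamics_algebra_def
      dynamics_map_def[abs_def] initial_projection Let_def)

lemma follower_projections_diagonal: "follower_projection L ` M \<subseteq> diagonal_algebra L"
proof -
  have "bounded (range (\<lambda>\<nu>. if \<mu> @ \<nu> \<in> L then 1 else 0 :: complex))" for \<mu>
    by (auto simp: bounded_iff)
  then show ?thesis unfolding diagonal_algebra_def follower_projection_def by blast
qed

lemmas dynamics_algebra_concrete =
  cstar_generated_concrete[OF follower_projections_diagonal, of L L for L, folded dynamics_algebra_def]
lemmas dynamics_algebra_diagonal =
  cstar_generated_diagonal[OF follower_projections_diagonal, of L L for L, folded dynamics_algebra_def]

lemma follower_projection_in_algebra:
  assumes "factor_closed L" shows "follower_projection L \<mu> \<in> dynamics_algebra L"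
proof (cases "\<mu> \<in> L")
  case True
  then show ?thesis unfolding dynamics_algebra_def cstar_generated_def by (simp add: hull_inc)
next
  case False
  then show ?thesis
    using concrete_cstar_algebraD(2)[OF dynamics_algebra_concrete] follower_projection_eq_0_iff[OF assms]
    by metis
qed

text \<open>
  The empty word gives the unit of the algebra, which a conjugacy therefore preserves.
  For \<open>L = {}\<close>, as for the empty subshift, this unit is \<open>0\<close>.
\<close>

lemma follower_projection_Nil_unit:
  assumes "a \<in> dynamics_algebra L"
  shows "follower_projection L [] \<circ> a = a" "a \<circ> follower_projection L [] = a"
proof -
  have "a \<in> bounded_operators L"
    using assms concrete_cstar_algebraD(1)[OF dynamics_algebra_concrete] by blast
  note a = bounded_operatorsD[OF this]
  have id: "follower_projection L [] f = (if f \<in> l2 L then f else (\<lambda>_. 0))" for f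
    by (auto simp: follower_projection_def diagonal_def fun_eq_iff l2_outside)
  show "follower_projection L [] \<circ> a = a"
  proof
    fix f show "(follower_projection L [] \<circ> a) f = a f"
      by (cases "f \<in> l2 L") (simp_all add: id a)
  qed
  have "a (\<lambda>_. 0) = (\<lambda>_. 0)" using a(3)[of "\<lambda>_. 0" 0] by simp
  then show "a \<circ> follower_projection L [] = a"
    by (auto simp: fun_eq_iff id a)
qed

text \<open>
  A conjugacy preserves the unit and intertwines the maps, so by induction on the word it carries
  the projection of \<open>\<mu>\<close> to that of the relabelled word. Being injective it detects whether a
  projection is \<open>0\<close>.
\<close>

lemma conjugate_systems_allowed_words:
  fixes I :: "'a ncpoly set" and J :: "'b ncpoly set"
  assumes L: "factor_closed (allowed_words I)" and M: "factor_closed (allowed_words J)"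
    and conj: "conjugate_systems (quantised_dynamics I) (quantised_dynamics J)"
  obtains \<pi> where "bij \<pi>" "\<And>\<mu>. map \<pi> \<mu> \<in> allowed_words J \<longleftrightarrow> \<mu> \<in> allowed_words I"
proof -
  let ?L = "allowed_words I" and ?M = "allowed_words J"
  let ?A = "dynamics_algebra ?L" and ?B = "dynamics_algebra ?M"
  obtain \<pi> \<gamma> where \<pi>: "bij \<pi>" and bij: "bij_betw \<gamma> ?A ?B"
    and mult: "\<forall>a\<in>?A. \<forall>b\<in>?A. \<gamma> (a \<circ> b) = \<gamma> a \<circ> \<gamma> b"
    and scale: "\<forall>c. \<forall>a\<in>?A. \<gamma> (op_scale c a) = op_scale c (\<gamma> a)"
    and inter: "\<forall>i. \<forall>a\<in>?A. \<gamma> (dynamics_map ?L i a) = dynamics_map ?M (\<pi> i) (\<gamma> a)"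
    using conj unfolding conjugate_systems_def star_isomorphism_def
    by (auto simp: quantised_dynamics_conv[OF L] quantised_dynamics_conv[OF M])
  note inA = follower_projection_in_algebra[OF L] and inB = follower_projection_in_algebra[OF M]
  have zA: "(\<lambda>_ _. 0) \<in> ?A" by (rule concrete_cstar_algebraD(2)[OF dynamics_algebra_concrete])
  have zero: "\<gamma> (\<lambda>_ _. 0) = (\<lambda>_ _. 0)"
    using scale[rule_format, OF zA, of 0] by (simp add: op_scale_def)
  \<comment> \<open>Multiplicativity and surjectivity suffice: \<open>\<gamma>(1)\<close> is a unit for the range of \<open>\<gamma>\<close>.\<close>
  have one: "\<gamma> (follower_projection ?L []) = follower_projection ?M []"
  proof -
    obtain a where a: "a \<in> ?A" "\<gamma> a = follower_projection ?M []"
      using bij inB[of "[]"] unfolding bij_betw_def by (metis imageE)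
    have "\<gamma> (follower_projection ?L []) \<in> ?B" using bij_betwE[OF bij] inA by blast
    then have "\<gamma> (follower_projection ?L []) = \<gamma> (follower_projection ?L []) \<circ> \<gamma> a"
      by (simp only: a(2) follower_projection_Nil_unit(2))
    also have "\<dots> = \<gamma> (follower_projection ?L [] \<circ> a)"
      using mult inA a(1) by simp
    finally show ?thesis using a by (simp only: follower_projection_Nil_unit(1))
  qed
  have proj: "\<gamma> (follower_projection ?L \<mu>) = follower_projection ?M (map \<pi> \<mu>)" for \<mu>
  proof (induction \<mu> rule: rev_induct)
    case (snoc i \<mu>)
    then show ?case
      using inter[rule_format, OF inA, of i \<mu>]
      by (simp add: dynamics_map_def quantised_map_follower_projection L M)
  qed (simp add: one)
  have "map \<pi> \<mu> \<in> ?M \<longleftrightarrow> \<mu> \<in> ?L" for \<mu>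
  proof -
    have "follower_projection ?M (map \<pi> \<mu>) = (\<lambda>_ _. 0) \<longleftrightarrow> \<gamma> (follower_projection ?L \<mu>) = \<gamma> (\<lambda>_ _. 0)"
      by (simp only: proj zero)
    also have "\<dots> \<longleftrightarrow> follower_projection ?L \<mu> = (\<lambda>_ _. 0)"
      using bij inA zA unfolding bij_betw_def by (metis inj_onD)
    finally show ?thesis
      by (simp add: follower_projection_eq_0_iff L M)
  qed
  with \<pi> show thesis by (rule that)
qed

lemma bij_map: "bij \<pi> \<Longrightarrow> bij (map \<pi>)"
  by (metis bij_def inj_mapI surj_def ex_map_conv)

lemma transport_follower_projection:
  assumes \<pi>: "bij \<pi>"
  shows "transport (map \<pi>) (follower_projection L \<mu>) = follower_projection (map \<pi> ` L) (map \<pi> \<mu>)"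
proof -
  note \<rho> = bij_map[OF \<pi>]
  have "transport (map \<pi>) (follower_projection L \<mu>) f (map \<pi> \<nu>) =
    follower_projection (map \<pi> ` L) (map \<pi> \<mu>) f (map \<pi> \<nu>)" for f \<nu>
  proof -
    have "map \<pi> \<mu> @ map \<pi> \<nu> \<in> map \<pi> ` L \<longleftrightarrow> \<mu> @ \<nu> \<in> L"
      using inj_image_mem_iff[OF bij_is_inj[OF \<rho>], of "\<mu> @ \<nu>" L] by simp
    then show ?thesis
      using \<rho> by (simp add: transport_def follower_projection_def diagonal_def l2_reindex
          inv_f_f[OF bij_is_inj[OF \<rho>]])
  qed
  then show ?thesis using \<rho> by (metis bij_pointE ext)
qed

lemma transport_creation:
  assumes \<pi>: "bij \<pi>"
  shows "transport (map \<pi>) (creation L i) = creation (map \<pi> ` L) (\<pi> i)"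
proof -
  note \<rho> = bij_map[OF \<pi>]
  have "transport (map \<pi>) (creation L i) f (map \<pi> \<nu>) = creation (map \<pi> ` L) (\<pi> i) f (map \<pi> \<nu>)" for f \<nu>
  proof -
    have "map \<pi> \<nu> \<in> map \<pi> ` L \<longleftrightarrow> \<nu> \<in> L"
      by (rule inj_image_mem_iff[OF bij_is_inj[OF \<rho>]])
    moreover have "hd (map \<pi> \<nu>) = \<pi> i \<longleftrightarrow> hd \<nu> = i" if "\<nu> \<noteq> []"
      using that bij_is_inj[OF \<pi>] by (simp add: hd_map inj_eq)
    ultimately show ?thesis
      using \<rho> by (auto simp: transport_def creation_def l2_reindex map_tl
          inv_f_f[OF bij_is_inj[OF \<rho>]])
  qed
  then show ?thesis using \<rho> by (metis bij_pointE ext)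
qed

lemma transport_dynamics_map:
  assumes \<pi>: "bij \<pi>" and L: "factor_closed L"
  shows "transport (map \<pi>) (dynamics_map L i a)
    = dynamics_map (map \<pi> ` L) (\<pi> i) (transport (map \<pi>) a)"
proof -
  have "is_adjoint L (creation L i) (pullback L {v. [i] @ v \<in> L} ((@) [i]))"
    using creation_word_adjoint[OF L, of "[i]"] by (simp only: creation_word_singleton)
  from transport_adjoint[OF bij_map[OF \<pi>] this] show ?thesis
    by (simp add: dynamics_map_def transport_comp[OF bij_map[OF \<pi>]] transport_creation[OF \<pi>])
qed

lemma transport_dynamics_algebra:
  assumes \<pi>: "bij \<pi>"
  shows "transport (map \<pi>) ` dynamics_algebra L = dynamics_algebra (map \<pi> ` L)"
proof -
  have "transport (map \<pi>) ` follower_projection L ` L = follower_projection (map \<pi> ` L) ` map \<pi> ` L"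
    by (simp add: image_image transport_follower_projection[OF \<pi>])
  then show ?thesis
    using transport_generated[OF bij_map[OF \<pi>], of "follower_projection L ` L" L]
    by (simp add: dynamics_algebra_def follower_projections_diagonal)
qed

text \<open>
  Relabelling the words is a bijection of the orthonormal bases that matches the creation operators,
  so conjugation by the resulting unitary is a conjugacy of the systems.
\<close>

lemma conjugate_systems_of_allowed_words:
  fixes I :: "'a ncpoly set" and J :: "'b ncpoly set"
  assumes L: "factor_closed (allowed_words I)" and M: "factor_closed (allowed_words J)"
    and \<pi>: "bij \<pi>" and eq: "allowed_words J = map \<pi> ` allowed_words I"
  shows "conjugate_systems (quantised_dynamics I) (quantised_dynamics J)"
proof -
  let ?L = "allowed_words I" and ?\<gamma> = "transport (map \<pi>) :: 'a list operator \<Rightarrow> 'b list operator"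
  note \<rho> = bij_map[OF \<pi>]
  have adj: "?\<gamma> (op_adjoint ?L a) = op_adjoint (map \<pi> ` ?L) (?\<gamma> a)" if "a \<in> dynamics_algebra ?L" for a
    using that dynamics_algebra_diagonal diagonal_algebra_adjoint transport_adjoint[OF \<rho>] by (metis subsetD)
  have "bij_betw ?\<gamma> (dynamics_algebra ?L) (dynamics_algebra (map \<pi> ` ?L))"
    unfolding bij_betw_def transport_dynamics_algebra[OF \<pi>]
    using transport_inv[OF \<rho>] by (auto intro: inj_on_inverseI)
  then show ?thesis
    unfolding conjugate_systems_def star_isomorphism_def
      quantised_dynamics_conv[OF L] quantised_dynamics_conv[OF M]
    by (intro exI[of _ \<pi>] exI[of _ ?\<gamma>])
       (simp add: \<pi> eq adj transport_add transport_comp[OF \<rho>] transport_scale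
         transport_dynamics_map[OF \<pi> L])
qed

section \<open>Monomial ideals and their allowed words\<close>

lemma factor_closed_allowed_words:
  assumes "two_sided_ideal I" shows "factor_closed (allowed_words I)"
proof -
  have "monom_word (u @ v @ w) \<in> I" if "monom_word v \<in> I" for u v w
    using assms that unfolding two_sided_ideal_def
    by (simp only: monom_word_mult[symmetric])
  then show ?thesis unfolding factor_closed_def allowed_words_def by blast
qed

lemma monomial_ideal_two_sided:
  assumes "monomial_ideal I" shows "two_sided_ideal I"
proof -
  obtain M where "I = two_sided_ideal hull (monom_word ` M)"
    using assms by (auto simp: monomial_ideal_def)
  moreover have "two_sided_ideal (\<Inter>\<C>)" if "\<And>I. I \<in> \<C> \<Longrightarrow> two_sided_ideal I" for \<C> :: "'a ncpoly set set"
    using that unfolding two_sided_ideal_def by blast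
  ultimately show ?thesis by (simp add: hull_in)
qed

lemma two_sided_ideal_sum:
  "two_sided_ideal I \<Longrightarrow> (\<And>x. x \<in> F \<Longrightarrow> p x \<in> I) \<Longrightarrow> sum p F \<in> I"
  by (induction F rule: infinite_finite_induct) (auto simp: two_sided_ideal_def)

lemma poly_mapping_sum_single: "p = (\<Sum>\<mu>\<in>Poly_Mapping.keys p. Poly_Mapping.single \<mu> (Poly_Mapping.lookup p \<mu>))"
  by (rule poly_mapping_eqI)
    (auto simp: lookup_sum lookup_single when_def in_keys_iff)

text \<open>
  A monomial ideal is spanned by the monomials that it contains. For the nontrivial inclusion it is
  enough that the polynomials all of whose monomials lie in the ideal form a two-sided ideal
  containing the generators.
\<close>

lemma monomial_ideal_iff:
  fixes I :: "'a ncpoly set"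
  assumes I: "monomial_ideal I"
  shows "p \<in> I \<longleftrightarrow> Poly_Mapping.keys p \<inter> allowed_words I = {}"
proof
  assume "p \<in> I"
  obtain M where M: "I = two_sided_ideal hull (monom_word ` M)"
    using I by (auto simp: monomial_ideal_def)
  let ?K = "{p :: 'a ncpoly. Poly_Mapping.keys p \<inter> allowed_words I = {}}"
  note fc = factor_closed_allowed_words[OF monomial_ideal_two_sided[OF I]]
  have K: "q + p \<in> ?K" if "q \<in> ?K" "p \<in> ?K" for p q
    using that keys_add[of q p] by blast
  have K': "r * q \<in> ?K" "q * r \<in> ?K" if q: "q \<in> ?K" for q r
  proof -
    have "\<mu> \<notin> allowed_words I" if "\<mu> \<in> Poly_Mapping.keys (r * q)" for \<mu>
      using that q keys_mult[of r q] factor_closed_suffix[OF fc] by (fastforce simp: plus_list_def)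
    moreover have "\<mu> \<notin> allowed_words I" if "\<mu> \<in> Poly_Mapping.keys (q * r)" for \<mu>
      using that q keys_mult[of q r] factor_closed_prefix[OF fc] by (fastforce simp: plus_list_def)
    ultimately show "r * q \<in> ?K" "q * r \<in> ?K" by blast+
  qed
  have "two_sided_ideal ?K"
    unfolding two_sided_ideal_def using K K' by simp
  moreover have "monom_word ` M \<subseteq> ?K"
  proof -
    have "monom_word \<mu> \<in> I" if "\<mu> \<in> M" for \<mu> using that unfolding M by (simp add: hull_inc)
    then show ?thesis by (auto simp: monom_word_def allowed_words_def)
  qed
  ultimately have "two_sided_ideal hull (monom_word ` M) \<subseteq> ?K" by (intro hull_minimal)
  with \<open>p \<in> I\<close> M show "Poly_Mapping.keys p \<inter> allowed_words I = {}" by blast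
next
  assume p: "Poly_Mapping.keys p \<inter> allowed_words I = {}"
  have ideal: "two_sided_ideal I" by (rule monomial_ideal_two_sided[OF I])
  have "Poly_Mapping.single \<mu> (Poly_Mapping.lookup p \<mu>) \<in> I" if "\<mu> \<in> Poly_Mapping.keys p" for \<mu>
  proof -
    have "monom_word \<mu> \<in> I" using that p by (auto simp: allowed_words_def)
    then have "Poly_Mapping.single 0 (Poly_Mapping.lookup p \<mu>) * monom_word \<mu> \<in> I"
      using ideal by (simp add: two_sided_ideal_def)
    then show ?thesis by (simp add: monom_word_def mult_single)
  qed
  then show "p \<in> I"
    by (subst poly_mapping_sum_single) (rule two_sided_ideal_sum[OF ideal])
qed

lemma lookup_rename_vars:
  assumes "bij \<pi>"
  shows "Poly_Mapping.lookup (rename_vars \<pi> p) (map \<pi> \<mu>) = Poly_Mapping.lookup p \<mu>"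
proof -
  have "map \<pi> \<nu> = map \<pi> \<mu> \<longleftrightarrow> \<nu> = \<mu>" for \<nu>
    using bij_is_inj[OF bij_map[OF assms]] by (auto dest: injD)
  then show ?thesis
    by (auto simp: rename_vars_def lookup_sum lookup_single when_def in_keys_iff)
qed

lemma keys_rename_vars:
  assumes "bij \<pi>" shows "Poly_Mapping.keys (rename_vars \<pi> p) = map \<pi> ` Poly_Mapping.keys p"
proof -
  have "map \<pi> \<mu> \<in> Poly_Mapping.keys (rename_vars \<pi> p) \<longleftrightarrow> map \<pi> \<mu> \<in> map \<pi> ` Poly_Mapping.keys p" for \<mu>
    by (simp add: in_keys_iff lookup_rename_vars[OF assms]
        inj_image_mem_iff[OF bij_is_inj[OF bij_map[OF assms]]])
  then show ?thesis using bij_map[OF assms] by (metis bij_pointE subset_antisym subsetI)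
qed

lemma rename_vars_inv:
  assumes "bij \<pi>" shows "rename_vars \<pi> (rename_vars (inv \<pi>) p) = p"
proof (rule poly_mapping_eqI)
  fix \<nu>
  have *: "\<nu> = map \<pi> (map (inv \<pi>) \<nu>)"
    using assms by (simp add: bij_is_surj surj_iff[symmetric] map_idI surj_f_inv_f)
  show "Poly_Mapping.lookup (rename_vars \<pi> (rename_vars (inv \<pi>) p)) \<nu> = Poly_Mapping.lookup p \<nu>"
    by (subst *) (simp only: lookup_rename_vars assms bij_imp_bij_inv)
qed

lemma rename_vars_monom_word: "rename_vars \<pi> (monom_word \<mu>) = monom_word (map \<pi> \<mu>)"
  by (simp add: rename_vars_def monom_word_def)

text \<open>
  Since a monomial ideal is determined by its monomials, renaming variables may be tested on the
  allowed words.
\<close>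

lemma rename_image_iff_allowed_words:
  assumes I: "monomial_ideal I" and J: "monomial_ideal J" and \<pi>: "bij \<pi>"
  shows "rename_vars \<pi> ` I = J \<longleftrightarrow> allowed_words J = map \<pi> ` allowed_words I"
proof -
  note \<rho> = bij_map[OF \<pi>]
  have inj: "rename_vars (inv \<pi>) (rename_vars \<pi> p) = p" for p
    using rename_vars_inv[OF bij_imp_bij_inv[OF \<pi>]] \<pi> by (simp add: inv_inv_eq)
  show ?thesis
  proof
    assume eq: "rename_vars \<pi> ` I = J"
    have "map \<pi> \<mu> \<in> allowed_words J \<longleftrightarrow> \<mu> \<in> allowed_words I" for \<mu>
      unfolding allowed_words_def eq[symmetric] using inj
      by (simp add: rename_vars_monom_word[symmetric]) (metis imageE imageI)
    then have "map \<pi> \<mu> \<in> allowed_words J \<longleftrightarrow> map \<pi> \<mu> \<in> map \<pi> ` allowed_words I" for \<mu>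
      by (simp add: inj_image_mem_iff[OF bij_is_inj[OF \<rho>]])
    then show "allowed_words J = map \<pi> ` allowed_words I"
      using \<rho> by (metis bij_pointE subset_antisym subsetI)
  next
    assume eq: "allowed_words J = map \<pi> ` allowed_words I"
    have mem: "rename_vars \<pi> p \<in> J \<longleftrightarrow> p \<in> I" for p
      unfolding monomial_ideal_iff[OF J] monomial_ideal_iff[OF I] keys_rename_vars[OF \<pi>] eq
      by (simp add: image_Int[OF bij_is_inj[OF \<rho>], symmetric])
    show "rename_vars \<pi> ` I = J"
    proof (intro subset_antisym subsetI)
      fix q assume "q \<in> J"
      then show "q \<in> rename_vars \<pi> ` I"
        using mem[of "rename_vars (inv \<pi>) q"] by (metis rename_vars_inv[OF \<pi>] imageI)
    qed (auto simp: mem)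
  qed
qed

theorem conjugate_systems_iff_same_modulo_permutation:
  assumes I: "monomial_ideal I" and J: "monomial_ideal J"
  shows "conjugate_systems (quantised_dynamics I) (quantised_dynamics J) \<longleftrightarrow> same_modulo_permutation I J"
proof -
  note L = factor_closed_allowed_words[OF monomial_ideal_two_sided[OF I]]
    and M = factor_closed_allowed_words[OF monomial_ideal_two_sided[OF J]]
  show ?thesis
  proof
    assume "conjugate_systems (quantised_dynamics I) (quantised_dynamics J)"
    then obtain \<pi> where \<pi>: "bij \<pi>" and *: "\<And>\<mu>. map \<pi> \<mu> \<in> allowed_words J \<longleftrightarrow> \<mu> \<in> allowed_words I"
      using conjugate_systems_allowed_words[OF L M] by blast
    have "allowed_words J = map \<pi> ` allowed_words I"
      using * bij_pointE[OF bij_map[OF \<pi>]] by (metis image_iff subset_antisym subsetI)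
    then show "same_modulo_permutation I J"
      unfolding same_modulo_permutation_def
      using \<pi> rename_image_iff_allowed_words[OF I J \<pi>] by blast
  next
    assume "same_modulo_permutation I J"
    then obtain \<pi> where \<pi>: "bij \<pi>" "rename_vars \<pi> ` I = J"
      unfolding same_modulo_permutation_def by blast
    then have "allowed_words J = map \<pi> ` allowed_words I"
      using rename_image_iff_allowed_words[OF I J] by blast
    with \<pi>(1) show "conjugate_systems (quantised_dynamics I) (quantised_dynamics J)"
      by (rule conjugate_systems_of_allowed_words[OF L M])
  qed
qed

section \<open>Subshifts and their words\<close>

text \<open>
  The ideal of a subshift is given as a span; comparing coefficients shows that it contains no
  monomial besides those of the words which do not occur.
\<close>

lemma allowed_words_subshift_ideal:
  "allowed_words (subshift_ideal s \<Lambda>) = {\<mu>. \<exists>x\<in>\<Lambda>. occurs_in s \<mu> x}"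
proof -
  have "monom_word \<mu> \<in> subshift_ideal s \<Lambda> \<longleftrightarrow> (\<forall>x\<in>\<Lambda>. \<not> occurs_in s \<mu> x)" for \<mu>
  proof
    assume "\<forall>x\<in>\<Lambda>. \<not> occurs_in s \<mu> x"
    then show "monom_word \<mu> \<in> subshift_ideal s \<Lambda>"
      unfolding subshift_ideal_def monom_word_def
      by (intro CollectI exI[of _ "{\<mu>}"] exI[of _ "\<lambda>_. 1"]) simp
  next
    assume "monom_word \<mu> \<in> subshift_ideal s \<Lambda>"
    then obtain F c where F: "finite F" "\<forall>\<mu>\<in>F. \<forall>x\<in>\<Lambda>. \<not> occurs_in s \<mu> x"
      and sum: "monom_word \<mu> = (\<Sum>\<nu>\<in>F. Poly_Mapping.single \<nu> (c \<nu>))"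
      unfolding subshift_ideal_def by blast
    have "Poly_Mapping.lookup (monom_word \<mu>) \<mu> = (\<Sum>\<nu>\<in>F. if \<nu> = \<mu> then c \<nu> else 0)"
      unfolding sum by (simp add: lookup_sum lookup_single when_def)
    then have "\<mu> \<in> F" using F(1) by (auto simp: monom_word_def split: if_splits)
    with F(2) show "\<forall>x\<in>\<Lambda>. \<not> occurs_in s \<mu> x" by blast
  qed
  then show ?thesis by (auto simp: allowed_words_def)
qed

lemma occurs_in_factor:
  assumes "occurs_in s (u @ v @ w) x" shows "occurs_in s v x"
proof -
  obtain k where k: "\<forall>j<length (u @ v @ w). k + int j \<in> shift_index s \<and> x (k + int j) = (u @ v @ w) ! j"
    using assms by (auto simp: occurs_in_def)
  have "(k + int (length u)) + int j \<in> shift_index s \<and> x ((k + int (length u)) + int j) = v ! j"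
    if "j < length v" for j
    using k[rule_format, of "length u + j"] that by (simp add: nth_append add_ac)
  then show ?thesis unfolding occurs_in_def by blast
qed

lemma factor_closed_subshift: "factor_closed (allowed_words (subshift_ideal s \<Lambda>))"
  unfolding allowed_words_subshift_ideal factor_closed_def using occurs_in_factor by blast

text \<open>
  The amounts \<open>m\<close> for which the translate \<open>i \<mapsto> x (i + m)\<close> only uses coordinates that a sequence of
  the given kind has.
\<close>

definition shift_admissible :: "shift_kind \<Rightarrow> int \<Rightarrow> bool" where
  "shift_admissible s m \<longleftrightarrow> s = Two_Sided \<or> s = Left_Sided \<and> m \<le> 0 \<or> s = Right_Sided \<and> 0 \<le> m"

lemma topspace_full_shift: "topspace (full_shift s) = PiE (shift_index s) (\<lambda>_. UNIV)"
  by (simp add: full_shift_def)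

lemma subshift_extensional: "subshift s \<Lambda> \<Longrightarrow> x \<in> \<Lambda> \<Longrightarrow> x \<in> extensional (shift_index s)"
  unfolding subshift_def using closedin_subset topspace_full_shift by (fastforce simp: PiE_def)

text \<open>
  Iterating the shift map gives the translates in one direction. For two-sided sequences the other
  direction comes from surjectivity of the shift on \<open>\<Lambda>\<close>, by choosing preimages repeatedly.
\<close>

lemma subshift_translate:
  assumes \<Lambda>: "subshift s \<Lambda>" and m: "shift_admissible s m" and x: "x \<in> \<Lambda>"
  shows "\<exists>y\<in>\<Lambda>. \<forall>i\<in>shift_index s. y i = x (i + m)"
proof -
  have fwd: "shift_map s z \<in> \<Lambda>" if "z \<in> \<Lambda>" for z
    using \<Lambda> that by (auto simp: subshift_def split: if_splits)
  define d :: int where "d = (if s = Left_Sided then -1 else 1)"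
  have forward: "\<exists>y\<in>\<Lambda>. \<forall>i\<in>shift_index s. y i = x (i + d * int n)" for n
  proof (induction n)
    case 0
    show ?case using x by auto
  next
    case (Suc n)
    then obtain y where y: "y \<in> \<Lambda>" "\<forall>i\<in>shift_index s. y i = x (i + d * int n)" by blast
    have "shift_map s y i = x (i + d * int (Suc n))" if "i \<in> shift_index s" for i
      using that y(2) by (cases s) (auto simp: d_def algebra_simps)
    with fwd[OF y(1)] show ?case by blast
  qed
  show ?thesis
  proof (cases "s = Two_Sided \<and> m < 0")
    case True
    have "\<exists>y\<in>\<Lambda>. \<forall>i. y i = x (i - int n)" for n
    proof (induction n)
      case 0
      show ?case using x by auto
    next
      case (Suc n)
      then obtain y where y: "y \<in> \<Lambda>" "\<forall>i. y i = x (i - int n)" by blast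
      then have "y \<in> shift_map s ` \<Lambda>" using \<Lambda> True by (simp add: subshift_def)
      then obtain z where z: "z \<in> \<Lambda>" "y = shift_map s z" by blast
      have "z i = x (i - int (Suc n))" for i
        using y(2)[rule_format, of "i - 1"] z(2) True by (simp add: algebra_simps)
      with z(1) show ?case by blast
    qed
    from this[of "nat (- m)"] show ?thesis using True by auto
  next
    case False
    then have "d * int (nat \<bar>m\<bar>) = m"
      using m by (auto simp: d_def shift_admissible_def)
    with forward[of "nat \<bar>m\<bar>"] show ?thesis by simp
  qed
qed

text \<open>
  A subshift is determined by its words. If \<open>x\<close> were outside the closed set \<open>\<Lambda>\<close>, a basic
  neighbourhood of \<open>x\<close>, which restricts finitely many coordinates, would avoid \<open>\<Lambda>\<close>. But the word
  of \<open>x\<close> on a window covering these coordinates occurs in some element of \<open>\<Lambda>\<close>, and translating that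
  element moves the occurrence into the window.
\<close>

lemma subshift_determined_by_words:
  assumes \<Lambda>: "subshift s \<Lambda>" and x: "x \<in> extensional (shift_index s)"
    and words: "\<And>\<mu>. occurs_in s \<mu> x \<Longrightarrow> \<exists>y\<in>\<Lambda>. occurs_in s \<mu> y"
  shows "x \<in> \<Lambda>"
proof (rule ccontr)
  assume "x \<notin> \<Lambda>"
  have "openin (full_shift s) (topspace (full_shift s) - \<Lambda>)"
    using \<Lambda> by (simp add: subshift_def openin_closedin_eq[symmetric] openin_diff)
  moreover have "x \<in> topspace (full_shift s) - \<Lambda>"
    using x \<open>x \<notin> \<Lambda>\<close> by (simp add: topspace_full_shift PiE_def)
  ultimately have "\<exists>U. finite {i \<in> shift_index s. U i \<noteq> UNIV} \<and> x \<in> PiE (shift_index s) U \<and>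
      PiE (shift_index s) U \<subseteq> topspace (full_shift s) - \<Lambda>"
    unfolding full_shift_def openin_product_topology_alt topspace_discrete_topology by blast
  then obtain U where fin: "finite {i \<in> shift_index s. U i \<noteq> UNIV}"
    and xU: "x \<in> PiE (shift_index s) U" and sub: "PiE (shift_index s) U \<subseteq> topspace (full_shift s) - \<Lambda>"
    by blast
  let ?F = "{i \<in> shift_index s. U i \<noteq> UNIV}"
  have "finite (abs ` ?F)" using fin by simp
  then have "bdd_above (abs ` ?F)" by (rule bdd_above_finite)
  then obtain b where b: "\<forall>i\<in>?F. \<bar>i\<bar> \<le> b" unfolding bdd_above_def by blast
  define N where "N = nat b"
  have N: "\<bar>i\<bar> \<le> int N" if "i \<in> ?F" for i
    using b[rule_format, OF that] unfolding N_def by linarith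
  \<comment> \<open>The window starts at \<open>a\<close> and has length \<open>n\<close>. For one-sided sequences it ends, respectively starts, at the
    boundary \<open>0\<close>; this makes the translation below admissible.\<close>
  define a :: int where "a = (if s = Right_Sided then 0 else - int N)"
  define n where "n = (if s = Two_Sided then 2 * N + 1 else N + 1)"
  have idx: "a + int j \<in> shift_index s" if "j < n" for j
    using that by (cases s) (auto simp: a_def n_def)
  have "occurs_in s (map (\<lambda>j. x (a + int j)) [0..<n]) x"
    unfolding occurs_in_def using idx by (intro exI[of _ a]) simp
  then obtain y where y: "y \<in> \<Lambda>" "occurs_in s (map (\<lambda>j. x (a + int j)) [0..<n]) y"
    using words by blast
  then obtain k where k: "\<And>j. j < n \<Longrightarrow> k + int j \<in> shift_index s \<and> y (k + int j) = x (a + int j)"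
    unfolding occurs_in_def by auto
  have "shift_admissible s (k - a)"
    using k[of 0] k[of N] by (cases s) (auto simp: shift_admissible_def a_def n_def)
  then obtain z where z: "z \<in> \<Lambda>" "\<forall>i\<in>shift_index s. z i = y (i + (k - a))"
    using subshift_translate[OF \<Lambda> _ y(1)] by blast
  have "z i \<in> U i" if "i \<in> shift_index s" for i
  proof (cases "i \<in> ?F")
    case True
    define j where "j = nat (i - a)"
    have j: "j < n" "i = a + int j"
      using N[OF True] that by (cases s; simp add: j_def a_def n_def)+
    have "z i = x i"
      using z(2)[rule_format, OF that] k[OF j(1)] by (simp add: j(2) algebra_simps)
    with xU that show ?thesis by (auto simp: PiE_def)
  next
    case False
    with that show ?thesis by simp
  qed
  then have "z \<in> PiE (shift_index s) U"
    using subshift_extensional[OF \<Lambda> z(1)] by (simp add: PiE_def)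
  with sub z(1) show False by blast
qed

definition relabel :: "shift_kind \<Rightarrow> ('c \<Rightarrow> 'd) \<Rightarrow> (int \<Rightarrow> 'c) \<Rightarrow> (int \<Rightarrow> 'd)" where
  "relabel s \<pi> x = restrict (\<pi> \<circ> x) (shift_index s)"

lemma relabel_relabel_inv:
  assumes "bij \<pi>" "x \<in> extensional (shift_index s)"
  shows "relabel s \<pi> (relabel s (inv \<pi>) x) = x"
  using assms by (auto simp: relabel_def fun_eq_iff extensional_def bij_is_surj surj_f_inv_f)

lemma occurs_in_relabel:
  assumes "bij \<pi>" shows "occurs_in s (map \<pi> \<mu>) (relabel s \<pi> x) \<longleftrightarrow> occurs_in s \<mu> x"
  using bij_is_inj[OF assms] by (auto simp: occurs_in_def relabel_def inj_eq)

lemma relabel_shift_map: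
  "relabel s \<pi> (shift_map s x) = shift_map s (relabel s \<pi> x)"
  by (cases s) (auto simp: relabel_def fun_eq_iff)

lemma continuous_relabel: "continuous_map (full_shift s) (full_shift s) (relabel s \<pi>)"
proof -
  have "continuous_map (full_shift s) (discrete_topology UNIV) (\<lambda>x. relabel s \<pi> x i)"
    if i: "i \<in> shift_index s" for i
  proof -
    have "continuous_map (full_shift s) (discrete_topology UNIV) (\<lambda>x. x i)"
      unfolding full_shift_def by (rule continuous_map_product_projection[OF i])
    moreover have "continuous_map (discrete_topology UNIV) (discrete_topology UNIV) \<pi>" by simp
    ultimately have "continuous_map (full_shift s) (discrete_topology UNIV) (\<pi> \<circ> (\<lambda>x. x i))"
      by (rule continuous_map_compose)
    then show ?thesis using i by (simp add: relabel_def o_def)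
  qed
  then have "continuous_map (full_shift s)
      (product_topology (\<lambda>_. discrete_topology UNIV) (shift_index s)) (relabel s \<pi>)"
    unfolding continuous_map_componentwise by (auto simp: relabel_def)
  then show ?thesis by (simp only: full_shift_def[symmetric])
qed

text \<open>
  Relabelling the symbols carries the words of \<open>\<Lambda>\<close> to words of \<open>\<Gamma>\<close>, and \<open>\<Gamma>\<close> contains every
  sequence whose words all occur in it.
\<close>

lemma relabel_subset:
  assumes \<pi>: "bij \<pi>" and \<Lambda>: "subshift s \<Lambda>" and \<Gamma>: "subshift s \<Gamma>"
    and words: "\<And>\<mu>. (\<exists>x\<in>\<Lambda>. occurs_in s \<mu> x) \<Longrightarrow> \<exists>y\<in>\<Gamma>. occurs_in s (map \<pi> \<mu>) y"
  shows "relabel s \<pi> ` \<Lambda> \<subseteq> \<Gamma>"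
proof
  fix y assume "y \<in> relabel s \<pi> ` \<Lambda>"
  then obtain x where x: "x \<in> \<Lambda>" "y = relabel s \<pi> x" by blast
  show "y \<in> \<Gamma>"
  proof (rule subshift_determined_by_words[OF \<Gamma>])
    show "y \<in> extensional (shift_index s)" by (simp add: x relabel_def)
    fix \<nu> assume \<nu>: "occurs_in s \<nu> y"
    obtain \<mu> where "\<nu> = map \<pi> \<mu>" using bij_pointE[OF bij_map[OF \<pi>]] by metis
    with \<nu> x words[of \<mu>] show "\<exists>y\<in>\<Gamma>. occurs_in s \<nu> y"
      using occurs_in_relabel[OF \<pi>] by blast
  qed
qed

lemma conjugate_subshifts_of_words:
  assumes \<pi>: "bij \<pi>" and \<Lambda>: "subshift s \<Lambda>" and \<Gamma>: "subshift s \<Gamma>"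
    and words: "\<And>\<mu>. (\<exists>y\<in>\<Gamma>. occurs_in s (map \<pi> \<mu>) y) \<longleftrightarrow> (\<exists>x\<in>\<Lambda>. occurs_in s \<mu> x)"
  shows "conjugate_subshifts s \<Lambda> \<Gamma>"
proof -
  have \<pi>': "bij (inv \<pi>)" by (rule bij_imp_bij_inv[OF \<pi>])
  have fwd: "relabel s \<pi> ` \<Lambda> \<subseteq> \<Gamma>"
    using words by (intro relabel_subset \<pi> \<Lambda> \<Gamma>) blast
  have map_inv: "map \<pi> (map (inv \<pi>) \<nu>) = \<nu>" for \<nu>
    using \<pi> by (simp add: map_idI bij_is_surj surj_f_inv_f)
  have bwd: "relabel s (inv \<pi>) ` \<Gamma> \<subseteq> \<Lambda>"
    using words[of "map (inv \<pi>) _", unfolded map_inv] by (intro relabel_subset \<pi>' \<Lambda> \<Gamma>) blast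
  have inv1: "relabel s \<pi> (relabel s (inv \<pi>) y) = y" if "y \<in> \<Gamma>" for y
    by (rule relabel_relabel_inv[OF \<pi> subshift_extensional[OF \<Gamma> that]])
  have inv2: "relabel s (inv \<pi>) (relabel s \<pi> x) = x" if "x \<in> \<Lambda>" for x
    using relabel_relabel_inv[OF \<pi>' subshift_extensional[OF \<Lambda> that]] \<pi> by (simp add: inv_inv_eq)
  have "homeomorphic_maps (subtopology (full_shift s) \<Lambda>) (subtopology (full_shift s) \<Gamma>)
      (relabel s \<pi>) (relabel s (inv \<pi>))"
    unfolding homeomorphic_maps_def
    using fwd bwd inv1 inv2
    by (auto simp: continuous_map_in_subtopology continuous_map_from_subtopology continuous_relabel)
  then show ?thesis
    unfolding conjugate_subshifts_def homeomorphic_map_maps using relabel_shift_map by blast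
qed

theorem theorem4p16:
  fixes I :: "('a::finite) ncpoly set" and J :: "('b::finite) ncpoly set"
  shows "(monomial_ideal I \<and> monomial_ideal J \<longrightarrow>
            (conjugate_systems (quantised_dynamics I) (quantised_dynamics J)
               \<longleftrightarrow> same_modulo_permutation I J)) \<and>
         (\<forall>s (\<Lambda> :: (int \<Rightarrow> 'c::finite) set) (\<Gamma> :: (int \<Rightarrow> 'c) set).
            subshift s \<Lambda> \<and> subshift s \<Gamma> \<and>
            conjugate_systems (quantised_dynamics (subshift_ideal s \<Lambda>))
                              (quantised_dynamics (subshift_ideal s \<Gamma>))
              \<longrightarrow> conjugate_subshifts s \<Lambda> \<Gamma>)"
proof (intro conjI impI allI)
  assume "monomial_ideal I \<and> monomial_ideal J"
  then show "conjugate_systems (quantised_dynamics I) (quantised_dynamics J)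
      \<longleftrightarrow> same_modulo_permutation I J"
    using conjugate_systems_iff_same_modulo_permutation by blast
next
  fix s and \<Lambda> \<Gamma> :: "(int \<Rightarrow> 'c) set"
  assume *: "subshift s \<Lambda> \<and> subshift s \<Gamma> \<and>
    conjugate_systems (quantised_dynamics (subshift_ideal s \<Lambda>)) (quantised_dynamics (subshift_ideal s \<Gamma>))"
  then obtain \<pi> :: "'c \<Rightarrow> 'c" where "bij \<pi>" and
    "\<And>\<mu>. map \<pi> \<mu> \<in> allowed_words (subshift_ideal s \<Gamma>) \<longleftrightarrow> \<mu> \<in> allowed_words (subshift_ideal s \<Lambda>)"
    using conjugate_systems_allowed_words[OF factor_closed_subshift factor_closed_subshift] by blast
  then show "conjugate_subshifts s \<Lambda> \<Gamma>"
    using * by (intro conjugate_subshifts_of_words) (simp_all add: allowed_words_subshift_ideal)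
qed

end
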